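(* Let $G$ be a fixed Coxeter group with generating set $\Sigma=\{a_1,\ldots,a_n\}$ given by a fixed Coxeter matrix $M$. There is a deterministic logspace transducer which on input $w\in\Sigma^*$ computes the set of letters occurring in the shortlex normal form of (the element of $G$ represented by) $w$.
   Context: A Coxeter group $G$ is given by a generating set $\Sigma=\{a_1,\ldots,a_n\}$ and a symmetric $n\times n$ matrix $M=(m_{i,j})$ over $\mathbb{N}=\{0,1,2,\ldots\}$ with $m_{i,j}=1\iff i=j$; the defining relations are $(a_ia_j)^{m_{i,j}}=1$ for $1\le i,j\le n$. (An entry $m_{i,j}=0$ means no relation; it plays the role of $\infty$.) A geodesic for $g\in G$ is a word in $\Sigma^*$ of minimal length among all words representing $g$. With a fixed linear order on $\Sigma$, the shortlex normal form of $g$ is the lexicographically first word among all geodesics for $g$. A deterministic logspace transducer is a deterministic Turing machine with a read-only input tape, a read/write work tape of length $\mathcal{O}(\log n)$ (where here $n$ is the input length), and a write-only output tape written sequentially from left to right. The group (its generators and matrix) is fixed and is not part of the input. *)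

theory Defs
  imports "HOL-Algebra.Group" "HOL-Library.Landau_Symbols"
begin

section \<open>Groups given by generators and relators\<close>

text \<open>
  A letter \<open>(True, x)\<close> stands for the generator \<open>x\<close> and \<open>(False, x)\<close> for its formal inverse.
\<close>

type_synonym 'a gword = "(bool \<times> 'a) list"

inductive_set pres_rel :: "'a set \<Rightarrow> 'a gword set \<Rightarrow> 'a gword rel"
  for X :: "'a set" and R :: "'a gword set" where
  refl: "u \<in> lists (UNIV \<times> X) \<Longrightarrow> (u, u) \<in> pres_rel X R"
| cancel: "u @ [(b, x), (\<not> b, x)] @ v \<in> lists (UNIV \<times> X) \<Longrightarrow>
    (u @ [(b, x), (\<not> b, x)] @ v, u @ v) \<in> pres_rel X R"
| relator: "u @ r @ v \<in> lists (UNIV \<times> X) \<Longrightarrow> r \<in> R \<Longrightarrow> (u @ r @ v, u @ v) \<in> pres_rel X R"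
| sym: "(u, v) \<in> pres_rel X R \<Longrightarrow> (v, u) \<in> pres_rel X R"
| trans: "(u, v) \<in> pres_rel X R \<Longrightarrow> (v, w) \<in> pres_rel X R \<Longrightarrow> (u, w) \<in> pres_rel X R"

definition presented_group :: "'a set \<Rightarrow> 'a gword set \<Rightarrow> 'a gword set monoid" where
  "presented_group X R =
    \<lparr>carrier = lists (UNIV \<times> X) // pres_rel X R,
     mult = (\<lambda>A B. pres_rel X R `` {u @ v | u v. u \<in> A \<and> v \<in> B}),
     one = pres_rel X R `` {[]}\<rparr>"

lemma pres_rel_lists:
  "(u, v) \<in> pres_rel X R \<Longrightarrow> u \<in> lists (UNIV \<times> X) \<and> v \<in> lists (UNIV \<times> X)"
  by (induction rule: pres_rel.induct) auto

lemma equiv_pres_rel: "equiv (lists (UNIV \<times> X)) (pres_rel X R)"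
proof (rule equivI)
  show "pres_rel X R \<subseteq> lists (UNIV \<times> X) \<times> lists (UNIV \<times> X)"
    using pres_rel_lists by fast
  show "refl_on (lists (UNIV \<times> X)) (pres_rel X R)"
    unfolding refl_on_def by (blast intro: pres_rel.refl)
  show "sym (pres_rel X R)" by (auto intro: symI pres_rel.sym)
  show "trans (pres_rel X R)" by (auto intro: transI pres_rel.trans)
qed

lemma pres_rel_context:
  assumes "(u, v) \<in> pres_rel X R" "p \<in> lists (UNIV \<times> X)" "q \<in> lists (UNIV \<times> X)"
  shows "(p @ u @ q, p @ v @ q) \<in> pres_rel X R"
  using assms
proof (induction rule: pres_rel.induct)
  case (refl u)
  then show ?case by (intro pres_rel.refl) auto
next
  case (cancel u b x v)
  then show ?case using pres_rel.cancel[of "p @ u" b x "v @ q" X R] by auto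
next
  case (relator u r v)
  then show ?case using pres_rel.relator[of "p @ u" r "v @ q" X R] by auto
qed (blast intro: pres_rel.sym pres_rel.trans)+

lemma pres_rel_append:
  assumes "(u, u') \<in> pres_rel X R" "(v, v') \<in> pres_rel X R"
  shows "(u @ v, u' @ v') \<in> pres_rel X R"
proof -
  have "([] @ u @ v, [] @ u' @ v) \<in> pres_rel X R"
    using assms pres_rel_lists by (intro pres_rel_context) fast+
  moreover have "(u' @ v @ [], u' @ v' @ []) \<in> pres_rel X R"
    using assms pres_rel_lists by (intro pres_rel_context) fast+
  ultimately show ?thesis by (auto intro: pres_rel.trans)
qed

lemma presented_group_mult:
  assumes "u \<in> lists (UNIV \<times> X)" "v \<in> lists (UNIV \<times> X)"
  shows "(pres_rel X R `` {u}) \<otimes>\<^bsub>presented_group X R\<^esub> (pres_rel X R `` {v})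
    = pres_rel X R `` {u @ v}"
proof -
  have "(u, u) \<in> pres_rel X R" "(v, v) \<in> pres_rel X R"
    using assms by (auto intro: pres_rel.refl)
  then show ?thesis
    unfolding presented_group_def
    by (auto dest: pres_rel_append intro: pres_rel.trans)
qed

lemma pres_rel_inverse:
  assumes "u \<in> lists (UNIV \<times> X)"
  shows "(rev (map (apfst Not) u) @ u, []) \<in> pres_rel X R"
  using assms
proof (induction u)
  case Nil
  then show ?case by (auto intro: pres_rel.refl)
next
  case (Cons a u)
  obtain b x where a: "a = (b, x)" by force
  let ?i = "rev (map (apfst Not) u)"
  have "?i \<in> lists (UNIV \<times> X)" using Cons by (auto simp: in_lists_conv_set)
  then have "(?i @ [(\<not> b, x), (\<not> \<not> b, x)] @ u, ?i @ u) \<in> pres_rel X R"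
    using Cons a by (intro pres_rel.cancel) auto
  then show ?case using Cons a by (auto intro: pres_rel.trans)
qed

lemma group_presented_group: "group (presented_group X R)"
proof (rule groupI, goal_cases)
  case (1 x y)
  then obtain u v where *: "u \<in> lists (UNIV \<times> X)" "v \<in> lists (UNIV \<times> X)"
      "x = pres_rel X R `` {u}" "y = pres_rel X R `` {v}"
    by (auto simp: presented_group_def elim!: quotientE)
  show ?case unfolding *(3,4) presented_group_mult[OF *(1,2)]
    using * by (auto simp: presented_group_def intro!: quotientI)
next
  case 2
  then show ?case by (auto simp: presented_group_def intro!: quotientI)
next
  case (3 x y z)
  then obtain u v w where *: "u \<in> lists (UNIV \<times> X)" "v \<in> lists (UNIV \<times> X)"
      "w \<in> lists (UNIV \<times> X)"
      "x = pres_rel X R `` {u}" "y = pres_rel X R `` {v}" "z = pres_rel X R `` {w}"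
    by (auto simp: presented_group_def elim!: quotientE)
  then have "u @ v \<in> lists (UNIV \<times> X)" "v @ w \<in> lists (UNIV \<times> X)" by auto
  with * show ?case by (simp only: presented_group_mult append_assoc)
next
  case (4 x)
  then obtain u where *: "u \<in> lists (UNIV \<times> X)" "x = pres_rel X R `` {u}"
    by (auto simp: presented_group_def elim!: quotientE)
  have "\<one>\<^bsub>presented_group X R\<^esub> = pres_rel X R `` {[]}" by (simp add: presented_group_def)
  with * show ?case using presented_group_mult[of "[]" X u R] by simp
next
  case (5 x)
  then obtain u where *: "u \<in> lists (UNIV \<times> X)" "x = pres_rel X R `` {u}"
    by (auto simp: presented_group_def elim!: quotientE)
  let ?i = "rev (map (apfst Not) u)"
  have i: "?i \<in> lists (UNIV \<times> X)" using * by (auto simp: in_lists_conv_set)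
  have "pres_rel X R `` {?i @ u} = pres_rel X R `` {[]}"
    using equiv_class_eq[OF equiv_pres_rel pres_rel_inverse[OF *(1)]] .
  then have "pres_rel X R `` {?i} \<otimes>\<^bsub>presented_group X R\<^esub> x = \<one>\<^bsub>presented_group X R\<^esub>"
    using presented_group_mult[OF i *(1), of R] *(2) by (simp add: presented_group_def)
  moreover have "pres_rel X R `` {?i} \<in> carrier (presented_group X R)"
    using i by (auto simp: presented_group_def intro!: quotientI)
  ultimately show ?case by blast
qed


section \<open>Coxeter groups and shortlex normal forms\<close>

text \<open>
  The index \<open>i \<in> {1..n}\<close> stands for the generator \<open>a\<^sub>i\<close>; only the entries \<open>M i j\<close> with
  \<open>i, j \<in> {1..n}\<close> are relevant.  The entry \<open>0\<close> contributes only the empty relator.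
\<close>

definition coxeter_matrix :: "nat \<Rightarrow> (nat \<Rightarrow> nat \<Rightarrow> nat) \<Rightarrow> bool" where
  "coxeter_matrix n M \<longleftrightarrow>
    (\<forall>i\<in>{1..n}. \<forall>j\<in>{1..n}. M i j = M j i \<and> (M i j = 1 \<longleftrightarrow> i = j))"

definition coxeter_relators :: "nat \<Rightarrow> (nat \<Rightarrow> nat \<Rightarrow> nat) \<Rightarrow> nat gword set" where
  "coxeter_relators n M =
    {concat (replicate (M i j) [(True, i), (True, j)]) | i j. i \<in> {1..n} \<and> j \<in> {1..n}}"

definition coxeter_group :: "nat \<Rightarrow> (nat \<Rightarrow> nat \<Rightarrow> nat) \<Rightarrow> nat gword set monoid" where
  "coxeter_group n M = presented_group {1..n} (coxeter_relators n M)"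

definition generator :: "nat \<Rightarrow> (nat \<Rightarrow> nat \<Rightarrow> nat) \<Rightarrow> nat \<Rightarrow> nat gword set" where
  "generator n M i = pres_rel {1..n} (coxeter_relators n M) `` {[(True, i)]}"

definition word_elem :: "nat \<Rightarrow> (nat \<Rightarrow> nat \<Rightarrow> nat) \<Rightarrow> nat list \<Rightarrow> nat gword set" where
  "word_elem n M w =
    foldr (\<lambda>i g. generator n M i \<otimes>\<^bsub>coxeter_group n M\<^esub> g) w \<one>\<^bsub>coxeter_group n M\<^esub>"

lemma word_elem_eq_class:
  assumes "w \<in> lists {1..n}"
  shows "word_elem n M w = pres_rel {1..n} (coxeter_relators n M) `` {map (Pair True) w}"
  using assms
proof (induction w)
  case Nil
  then show ?case by (simp add: word_elem_def coxeter_group_def presented_group_def)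
next
  case (Cons i w)
  then have "map (Pair True) w \<in> lists (UNIV \<times> {1..n})" "[(True, i)] \<in> lists (UNIV \<times> {1..n})"
    by (auto simp: in_lists_conv_set)
  from presented_group_mult[OF this(2,1), of "coxeter_relators n M"] Cons
  show ?case by (simp add: word_elem_def coxeter_group_def generator_def)
qed

definition geodesics :: "nat \<Rightarrow> (nat \<Rightarrow> nat \<Rightarrow> nat) \<Rightarrow> nat gword set \<Rightarrow> nat list set" where
  "geodesics n M g =
    {w \<in> lists {1..n}. word_elem n M w = g \<and>
      (\<forall>v\<in>lists {1..n}. word_elem n M v = g \<longrightarrow> length w \<le> length v)}"

definition shortlex_nf ::
  "nat \<Rightarrow> (nat \<Rightarrow> nat \<Rightarrow> nat) \<Rightarrow> nat rel \<Rightarrow> nat gword set \<Rightarrow> nat list" where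
  "shortlex_nf n M r g =
    (THE w. w \<in> geodesics n M g \<and> (\<forall>v\<in>geodesics n M g. v = w \<or> (w, v) \<in> lex (r - Id)))"

lemma lex_total_on_length:
  assumes "total_on A r" "u \<in> lists A" "v \<in> lists A" "length u = length v" "u \<noteq> v"
  shows "(u, v) \<in> lex (r - Id) \<or> (v, u) \<in> lex (r - Id)"
  using assms(4,5,2,3)
proof (induction u v rule: list_induct2)
  case (Cons x xs y ys)
  then show ?case using assms(1) by (cases "x = y") (auto simp: total_on_def)
qed simp

lemma lex_strict_antisym:
  assumes "antisym r" "(u, v) \<in> lex (r - Id)" "(v, u) \<in> lex (r - Id)"
  shows False
proof -
  have "length u = length v" using assms(2) by (auto simp: lex_conv)
  then show ?thesis using assms(2,3)
  proof (induction u v rule: list_induct2)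
    case (Cons x xs y ys)
    then show ?case using antisymD[OF assms(1), of x y] by (cases "x = y") simp_all
  qed simp
qed

lemma shortlex_nf_unique:
  fixes M :: "nat \<Rightarrow> nat \<Rightarrow> nat"
  assumes r: "linear_order_on {1..n} r" and w: "w \<in> lists {1..n}"
  defines "g \<equiv> word_elem n M w"
  shows "\<exists>!u. u \<in> geodesics n M g \<and> (\<forall>v\<in>geodesics n M g. v = u \<or> (u, v) \<in> lex (r - Id))"
proof -
  have tot: "total_on {1..n} r" and tr: "trans r" and anti: "antisym r"
    using r by (auto simp: order_on_defs)
  let ?P = "\<lambda>v. v \<in> lists {1..n} \<and> word_elem n M v = g"
  obtain u where u: "?P u" "\<And>v. ?P v \<Longrightarrow> length u \<le> length v"
    using ex_has_least_nat[of ?P w length] w unfolding g_def by metis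
  then have ne: "geodesics n M g \<noteq> {}" unfolding geodesics_def by blast
  have len: "length v = length u" if "v \<in> geodesics n M g" for v
  proof (rule le_antisym)
    show "length v \<le> length u" using that u(1) unfolding geodesics_def by blast
    show "length u \<le> length v" using that u(2) unfolding geodesics_def by blast
  qed
  have fin: "finite (geodesics n M g)"
  proof (rule finite_subset)
    show "geodesics n M g \<subseteq> {xs. set xs \<subseteq> {1..n} \<and> length xs = length u}"
      using len by (auto simp: geodesics_def)
  qed (simp add: finite_lists_length_eq)
  have tr': "trans (lex (r - Id))"
    using tr anti by (intro lex_transI trans_diff_Id)
  have "\<exists>m\<in>S. \<forall>v\<in>S. v = m \<or> (m, v) \<in> lex (r - Id)"
    if "finite S" "S \<noteq> {}" "S \<subseteq> geodesics n M g" for S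
    using that
  proof (induction S rule: finite_ne_induct)
    case (insert x S)
    then obtain m where m: "m \<in> S" "\<And>v. v \<in> S \<Longrightarrow> v = m \<or> (m, v) \<in> lex (r - Id)" by auto
    have xm: "x \<in> geodesics n M g" "m \<in> geodesics n M g" using insert.prems m(1) by auto
    then have "x \<in> lists {1..n}" "m \<in> lists {1..n}"
      unfolding geodesics_def by blast+
    moreover have "length x = length m"
      using len[OF xm(1)] len[OF xm(2)] by metis
    ultimately consider "x = m" | "(m, x) \<in> lex (r - Id)" | "(x, m) \<in> lex (r - Id)"
      using lex_total_on_length[OF tot] by metis
    then show ?case
    proof cases
      case 3
      then have "\<forall>v\<in>insert x S. v = x \<or> (x, v) \<in> lex (r - Id)"
        using m(2) transD[OF tr' 3] by auto
      then show ?thesis by auto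
    qed (use m in auto)
  qed simp
  from this[OF fin ne] obtain m where
    m: "m \<in> geodesics n M g" "\<forall>v\<in>geodesics n M g. v = m \<or> (m, v) \<in> lex (r - Id)"
    by auto
  show ?thesis
  proof (rule ex1I[of _ m])
    fix u
    assume u: "u \<in> geodesics n M g \<and> (\<forall>v\<in>geodesics n M g. v = u \<or> (u, v) \<in> lex (r - Id))"
    show "u = m"
    proof (rule ccontr)
      assume "u \<noteq> m"
      then have "(u, m) \<in> lex (r - Id)" "(m, u) \<in> lex (r - Id)" using m u by auto
      then show False by (rule lex_strict_antisym[OF anti])
    qed
  qed (use m in auto)
qed


section \<open>Deterministic logspace transducers\<close>

datatype 'a input_symbol = Left_End | Letter 'a | Right_End

datatype direction = Move_Left | Stay | Move_Right

text \<open>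
  \<open>delta q x s = (q', s', d\<^sub>i, d\<^sub>w, y)\<close>: in state \<open>q\<close>, reading \<open>x\<close> on the input tape and \<open>s\<close> on the
  work tape, the machine enters state \<open>q'\<close>, replaces \<open>s\<close> by \<open>s'\<close>, moves the input head in direction
  \<open>d\<^sub>i\<close> and the work head in direction \<open>d\<^sub>w\<close>, and appends the symbol \<open>y\<close>, if any, to the output.
\<close>

record ('q, 's, 'a, 'b) transducer =
  states :: "'q set"
  start :: 'q
  halt :: 'q
  work_symbols :: "'s set"
  blank :: 's
  delta :: "'q \<Rightarrow> 'a input_symbol \<Rightarrow> 's \<Rightarrow> 'q \<times> 's \<times> direction \<times> direction \<times> 'b option"

definition transducer :: "'a set \<Rightarrow> 'b set \<Rightarrow> ('q, 's, 'a, 'b) transducer \<Rightarrow> bool" where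
  "transducer A B T \<longleftrightarrow>
    finite A \<and> finite B \<and> finite (states T) \<and> finite (work_symbols T) \<and>
    start T \<in> states T \<and> halt T \<in> states T \<and> blank T \<in> work_symbols T \<and>
    (\<forall>q\<in>states T. \<forall>x\<in>insert Left_End (insert Right_End (Letter ` A)). \<forall>s\<in>work_symbols T.
      case delta T q x s of (q', s', _, _, y) \<Rightarrow>
        q' \<in> states T \<and> s' \<in> work_symbols T \<and> set_option y \<subseteq> B)"

text \<open>
  The input tape carries the end markers in the cells \<open>0\<close> and \<open>length w + 1\<close>, which the input head
  cannot pass.  The work tape is one-way infinite: moving left in cell \<open>0\<close> has no effect.
\<close>

record ('q, 's, 'b) config =
  state :: 'q
  input_pos :: nat
  work_tape :: "nat \<Rightarrow> 's"
  work_pos :: nat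
  output_word :: "'b list"

definition input_symbol_at :: "'a list \<Rightarrow> nat \<Rightarrow> 'a input_symbol" where
  "input_symbol_at w p =
    (if p = 0 then Left_End else if p \<le> length w then Letter (w ! (p - 1)) else Right_End)"

fun move :: "direction \<Rightarrow> nat \<Rightarrow> nat" where
  "move Move_Left p = p - 1"
| "move Stay p = p"
| "move Move_Right p = p + 1"

definition initial_config :: "('q, 's, 'a, 'b) transducer \<Rightarrow> ('q, 's, 'b) config" where
  "initial_config T =
    \<lparr>state = start T, input_pos = 0, work_tape = (\<lambda>_. blank T), work_pos = 0, output_word = []\<rparr>"

definition step ::
  "('q, 's, 'a, 'b) transducer \<Rightarrow> 'a list \<Rightarrow> ('q, 's, 'b) config \<Rightarrow> ('q, 's, 'b) config" where
  "step T w c =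
    (if state c = halt T then c
     else case delta T (state c) (input_symbol_at w (input_pos c)) (work_tape c (work_pos c)) of
       (q, s, di, dw, y) \<Rightarrow>
         \<lparr>state = q,
          input_pos = min (move di (input_pos c)) (length w + 1),
          work_tape = (work_tape c)(work_pos c := s),
          work_pos = move dw (work_pos c),
          output_word = output_word c @ (case y of None \<Rightarrow> [] | Some b \<Rightarrow> [b])\<rparr>)"

definition run :: "('q, 's, 'a, 'b) transducer \<Rightarrow> 'a list \<Rightarrow> nat \<Rightarrow> ('q, 's, 'b) config" where
  "run T w t = (step T w ^^ t) (initial_config T)"

definition computes :: "('q, 's, 'a, 'b) transducer \<Rightarrow> 'a list \<Rightarrow> 'b list \<Rightarrow> bool" where
  "computes T w u \<longleftrightarrow> (\<exists>t. state (run T w t) = halt T \<and> output_word (run T w t) = u)"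

definition logspace_transducer :: "'a set \<Rightarrow> 'b set \<Rightarrow> ('q, 's, 'a, 'b) transducer \<Rightarrow> bool" where
  "logspace_transducer A B T \<longleftrightarrow>
    transducer A B T \<and>
    (\<exists>space :: nat \<Rightarrow> nat.
      (\<lambda>m. real (space m)) \<in> O(\<lambda>m. ln (real m)) \<and>
      (\<forall>w\<in>lists A. \<forall>t. work_pos (run T w t) < space (length w)))"

end

theory Submission
  imports Defs
begin

text \<open>
  Let \<open>W\<close> act from the right on the linear functionals of the geometric representation.  If \<open>f\<close> is
  nonnegative on the simple roots and \<open>f w = f\<close> on the simple roots, then \<open>f\<close> vanishes at
  \<open>\<alpha>\<^sub>s\<close> for every letter \<open>s\<close> of a geodesic for \<open>w\<close>: for the last letter \<open>s\<close> the root \<open>w \<alpha>\<^sub>s\<close> is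
  negative, so \<open>f(\<alpha>\<^sub>s) = 0\<close>, and \<open>s\<close> can be dropped.  Hence \<open>a\<^sub>i\<close> does not occur in the normal
  form of \<open>w\<close> iff \<open>w\<close> fixes the functional dual to \<open>\<alpha>\<^sub>i\<close>.

  The values of functionals are integral combinations of the finitely many numbers
  \<open>2 cos (k \<pi> / L)\<close>, on whose coefficients a reflection acts by an integer matrix, and the vanishing of
  such a combination amounts to finitely many integral linear conditions.  So it remains to test in
  logarithmic space whether an iterated product of fixed integer matrices has a zero entry.  Such an
  entry is at most exponential in the length of \<open>w\<close>, so it suffices to compute it modulo
  all \<open>m\<close> up to a linear bound, which needs only counters with linearly bounded values.
\<close>

section \<open>Renaming states and work symbols\<close>

text \<open>A functional that is nonnegative on the simple roots is a point of the closed
  fundamental chamber, and its stabiliser is the parabolic subgroup generated by the simple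
  reflections that fix it. For the dual of alpha_i this subgroup omits exactly the generator a_i. So
  the letters are found by linear algebra, and no word is ever reduced. The numbers 2 cos (k pi / L)
  are linearly dependent over the rationals, so coordinates are not unique. Reflections tolerate
  this: 2 cos x * 2 cos y = 2 cos (x + y) + 2 cos (x - y) turns multiplication by a weight into an
  integer matrix, whatever coordinates were chosen. Only the zero test has to know the relations,
  and as the group is fixed they are hard-wired into the machine. With all moduli instead of primes,
  the machine need not recognise primes, and an elementary lower bound for the least common multiple
  of 1, ..., 2k + 1 suffices.\<close>

lemma input_symbol_at_mem:
  "w \<in> lists A \<Longrightarrow> input_symbol_at w p \<in> insert Left_End (insert Right_End (Letter ` A))"
  by (auto simp: input_symbol_at_def in_lists_conv_set)

lemma run_0: "run T w 0 = initial_config T"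
  by (simp add: run_def)

lemma run_Suc: "run T w (Suc t) = step T w (run T w t)"
  by (simp add: run_def)

text \<open>Compiled machines have programs as states and register sets in their symbols, whereas
  the final statement asks for numbers. Injections on the two finite sets suffice for the renaming
  because a run never leaves these sets.\<close>

lemma transducer_nat:
  fixes T :: "('q, 's, 'a, 'b) transducer"
  assumes T: "transducer A B T"
  shows "\<exists>T' :: (nat, nat, 'a, 'b) transducer. transducer A B T' \<and>
    (\<forall>w\<in>lists A. \<forall>t. work_pos (run T' w t) = work_pos (run T w t) \<and>
      output_word (run T' w t) = output_word (run T w t) \<and>
      (state (run T' w t) = halt T' \<longleftrightarrow> state (run T w t) = halt T))"
proof -
  define Q where "Q = states T"
  define G where "G = work_symbols T"
  have fin: "finite Q" "finite G" and st: "start T \<in> Q" "halt T \<in> Q" "blank T \<in> G"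
    using T by (auto simp: transducer_def Q_def G_def)
  obtain f :: "'q \<Rightarrow> nat" where f: "inj_on f Q" using finite_imp_inj_to_nat_seg[OF fin(1)] by blast
  obtain g :: "'s \<Rightarrow> nat" where g: "inj_on g G" using finite_imp_inj_to_nat_seg[OF fin(2)] by blast
  define T' where "T' = \<lparr>states = f ` Q, start = f (start T), halt = f (halt T),
    work_symbols = g ` G, blank = g (blank T),
    delta = (\<lambda>q x s. case delta T (inv_into Q f q) x (inv_into G g s) of
      (q', s', di, dw, y) \<Rightarrow> (f q', g s', di, dw, y))\<rparr>"
  have closed: "q' \<in> Q \<and> s' \<in> G \<and> set_option y \<subseteq> B"
    if "delta T q x s = (q', s', di, dw, y)" "q \<in> Q" "s \<in> G"
      "x \<in> insert Left_End (insert Right_End (Letter ` A))" for q x s q' s' di dw y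
    using T that unfolding transducer_def Q_def G_def by fastforce
  have delta': "delta T' (f q) x (g s) =
      (case delta T q x s of (q', s', di, dw, y) \<Rightarrow> (f q', g s', di, dw, y))"
    if "q \<in> Q" "s \<in> G" for q x s
    using that f g by (simp add: T'_def)
  have "transducer A B T'"
    unfolding transducer_def
  proof (intro conjI ballI)
    fix q x s
    assume q: "q \<in> states T'" and x: "x \<in> insert Left_End (insert Right_End (Letter ` A))"
      and s: "s \<in> work_symbols T'"
    obtain q0 s0 where q0: "q = f q0" "q0 \<in> Q" and s0: "s = g s0" "s0 \<in> G"
      using q s by (auto simp: T'_def)
    obtain q' s' di dw y where d: "delta T q0 x s0 = (q', s', di, dw, y)"
      using prod_cases5 by blast
    show "case delta T' q x s of (q', s', _, _, y) \<Rightarrow>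
        q' \<in> states T' \<and> s' \<in> work_symbols T' \<and> set_option y \<subseteq> B"
      using closed[OF d q0(2) s0(2) x] unfolding q0(1) s0(1) delta'[OF q0(2) s0(2)] d
      by (auto simp: T'_def)
  qed (use T fin st in \<open>auto simp: T'_def transducer_def\<close>)
  moreover have "run T' w t = \<lparr>state = f (state (run T w t)), input_pos = input_pos (run T w t),
      work_tape = g \<circ> work_tape (run T w t), work_pos = work_pos (run T w t),
      output_word = output_word (run T w t)\<rparr> \<and>
      state (run T w t) \<in> Q \<and> (\<forall>p. work_tape (run T w t) p \<in> G)" (is "?P t")
    if w: "w \<in> lists A" for w t
  proof (induction t)
    case 0
    then show ?case using st by (auto simp: run_0 initial_config_def T'_def)
  next
    case (Suc t)
    define c where "c = run T w t"
    have c: "run T' w t = \<lparr>state = f (state c), input_pos = input_pos c,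
      work_tape = g \<circ> work_tape c, work_pos = work_pos c, output_word = output_word c\<rparr>"
      "state c \<in> Q" "\<And>p. work_tape c p \<in> G"
      using Suc by (simp_all add: c_def comp_def)
    have halt: "f (state c) = halt T' \<longleftrightarrow> state c = halt T"
      using f c(2) st(2) by (auto simp: T'_def inj_on_eq_iff)
    obtain q' s' di dw y where
      d: "delta T (state c) (input_symbol_at w (input_pos c)) (work_tape c (work_pos c))
        = (q', s', di, dw, y)"
      using prod_cases5 by blast
    note cl = closed[OF d c(2,3) input_symbol_at_mem[OF w]]
    show ?case
      using c cl unfolding run_Suc c(1) c_def[symmetric] step_def
      by (auto simp: halt delta' d fun_eq_iff)
  qed
  moreover have "f (state (run T w t)) = halt T' \<longleftrightarrow> state (run T w t) = halt T"
    if "state (run T w t) \<in> Q" for w t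
    using f that st(2) by (auto simp: T'_def inj_on_eq_iff)
  ultimately show ?thesis by (intro exI[of _ T']) simp
qed


section \<open>While programs over counters\<close>

datatype ('r, 'a, 'b) instr =
  Inc 'r | Zero 'r | Go direction | Put 'b | Neq 'r 'r | Sym "'a input_symbol \<Rightarrow> bool"

datatype ('r, 'a, 'b) com =
  Skip
| Prim "('r, 'a, 'b) instr"
| Seq "('r, 'a, 'b) com" "('r, 'a, 'b) com" (infixr ";;" 60)
| Cond "('r, 'a, 'b) instr" "('r, 'a, 'b) com" "('r, 'a, 'b) com"
| While "('r, 'a, 'b) instr" "('r, 'a, 'b) com"

record ('r, 'b) store =
  reg :: "'r \<Rightarrow> nat"
  pos :: nat
  out :: "'b list"

fun effect :: "'a list \<Rightarrow> ('r, 'a, 'b) instr \<Rightarrow> ('r, 'b) store \<Rightarrow> ('r, 'b) store" where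
  "effect w (Inc r) s = s\<lparr>reg := (reg s)(r := Suc (reg s r))\<rparr>"
| "effect w (Zero r) s = s\<lparr>reg := (reg s)(r := 0)\<rparr>"
| "effect w (Go d) s = s\<lparr>pos := min (move d (pos s)) (length w + 1)\<rparr>"
| "effect w (Put b) s = s\<lparr>out := out s @ [b]\<rparr>"
| "effect w (Neq r r') s = s"
| "effect w (Sym P) s = s"

fun outcome :: "'a list \<Rightarrow> ('r, 'a, 'b) instr \<Rightarrow> ('r, 'b) store \<Rightarrow> bool" where
  "outcome w (Neq r r') s \<longleftrightarrow> reg s r \<noteq> reg s r'"
| "outcome w (Sym P) s \<longleftrightarrow> P (input_symbol_at w (pos s))"
| "outcome w i s \<longleftrightarrow> True"

fun fits :: "nat \<Rightarrow> ('r, 'a, 'b) instr \<Rightarrow> ('r, 'b) store \<Rightarrow> bool" where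
  "fits b (Inc r) s \<longleftrightarrow> reg s r < b"
| "fits b i s \<longleftrightarrow> True"

text \<open>A leading \<open>Skip\<close> is consumed by a dummy test. Thus every unfinished program
  has a next instruction, and \<open>head\<close> with \<open>cont\<close> describes the whole
  control flow one instruction at a time.\<close>

fun head :: "('r, 'a, 'b) com \<Rightarrow> ('r, 'a, 'b) instr" where
  "head Skip = Sym (\<lambda>_. True)"
| "head (Prim i) = i"
| "head (Seq c d) = head c"
| "head (Cond i c d) = i"
| "head (While i c) = i"

fun cont :: "('r, 'a, 'b) com \<Rightarrow> bool \<Rightarrow> ('r, 'a, 'b) com" where
  "cont Skip y = Skip"
| "cont (Prim i) y = Skip"
| "cont (Seq c d) y = (if c = Skip then d else Seq (cont c y) d)"
| "cont (Cond i c d) y = (if y then c else d)"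
| "cont (While i c) y = (if y then Seq c (While i c) else Skip)"

text \<open>A step is blocked if it would push a counter beyond \<open>b\<close>, so a completed
  execution is itself the certificate for the space bound.\<close>

definition small ::
  "'a list \<Rightarrow> nat \<Rightarrow> (('r, 'a, 'b) com \<times> ('r, 'b) store) rel" where
  "small w b = {((c, s), (cont c (outcome w (head c) s), effect w (head c) s)) | c s.
    c \<noteq> Skip \<and> fits b (head c) s}"

definition exec ::
  "'a list \<Rightarrow> nat \<Rightarrow> ('r, 'a, 'b) com \<Rightarrow> ('r, 'b) store \<Rightarrow> ('r, 'b) store \<Rightarrow> bool" where
  "exec w b c s s' \<longleftrightarrow> ((c, s), (Skip, s')) \<in> (small w b)\<^sup>*"

lemma smallI:
  "c \<noteq> Skip \<Longrightarrow> fits b (head c) s \<Longrightarrow> c' = cont c (outcome w (head c) s) \<Longrightarrow>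
    s' = effect w (head c) s \<Longrightarrow> ((c, s), (c', s')) \<in> small w b"
  by (auto simp: small_def)

lemma exec_Skip: "exec w b Skip s s"
  by (simp add: exec_def)

lemma exec_Prim: "fits b i s \<Longrightarrow> exec w b (Prim i) s (effect w i s)"
  unfolding exec_def by (rule r_into_rtrancl, rule smallI) auto

lemma exec_Seq:
  assumes "exec w b c s s'" "exec w b d s' s''"
  shows "exec w b (c ;; d) s s''"
proof -
  have "((c ;; d, s), (c' ;; d, s')) \<in> (small w b)\<^sup>*" if "((c, s), (c', s')) \<in> (small w b)\<^sup>*" for c'
    using that
  proof (induction rule: rtrancl_induct2)
    case (step c1 s1 c2 s2)
    then have "((c1 ;; d, s1), (c2 ;; d, s2)) \<in> small w b" by (auto simp: small_def)
    with step.IH show ?case by (rule rtrancl_into_rtrancl)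
  qed simp
  moreover have "((Skip ;; d, s'), (d, s')) \<in> small w b"
    by (rule smallI) auto
  ultimately show ?thesis using assms unfolding exec_def by (meson converse_rtrancl_into_rtrancl rtrancl_trans)
qed

lemma exec_Cond:
  assumes "fits b i s" "exec w b (if outcome w i s then c else d) (effect w i s) s'"
  shows "exec w b (Cond i c d) s s'"
proof -
  have "((Cond i c d, s), (if outcome w i s then c else d, effect w i s)) \<in> small w b"
    using assms(1) by (intro smallI) auto
  then show ?thesis using assms(2) unfolding exec_def by (rule converse_rtrancl_into_rtrancl)
qed

lemma exec_While:
  assumes "fits b i s"
    "exec w b (if outcome w i s then c ;; While i c else Skip) (effect w i s) s'"
  shows "exec w b (While i c) s s'"
proof -
  have "((While i c, s), (if outcome w i s then c ;; While i c else Skip, effect w i s)) \<in> small w b"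
    using assms(1) by (intro smallI) auto
  then show ?thesis using assms(2) unfolding exec_def by (rule converse_rtrancl_into_rtrancl)
qed


section \<open>Compiling while programs to Turing machines\<close>

text \<open>
  The counters are stored in binary, least significant digit first, on parallel tracks: cell
  \<open>j + 1\<close> of the work tape holds the set of those registers whose \<open>j\<close>-th binary digit is \<open>1\<close>, and
  cell \<open>0\<close> holds an end marker.  A register instruction is carried out in one sweep to the right,
  with a carry bit in the finite control, and one sweep back.  The states are the residuals of the
  program.
\<close>

datatype 'r cell = Blank | Mark | Col "'r set"

datatype phase = Idle | Fwd bool | Bwd bool

fun digit :: "('r, 'a, 'b) instr \<Rightarrow> bool \<Rightarrow> 'r set \<Rightarrow> 'r set" where
  "digit (Inc r) y v = (if y then if r \<in> v then v - {r} else insert r v else v)"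
| "digit (Zero r) y v = v - {r}"
| "digit i y v = v"

text \<open>The bit has two meanings: for \<open>Inc\<close> it is the arithmetic carry, for
  \<open>Neq\<close> it remembers that some digit differed.\<close>

fun carry :: "('r, 'a, 'b) instr \<Rightarrow> bool \<Rightarrow> 'r set \<Rightarrow> bool" where
  "carry (Inc r) y v \<longleftrightarrow> y \<and> r \<in> v"
| "carry (Neq r r') y v \<longleftrightarrow> y \<or> (r \<in> v) \<noteq> (r' \<in> v)"
| "carry i y v \<longleftrightarrow> y"

fun overflow :: "('r, 'a, 'b) instr \<Rightarrow> bool \<Rightarrow> 'r set list" where
  "overflow (Inc r) y = (if y then [{r}] else [])"
| "overflow i y = []"

fun first_carry :: "('r, 'a, 'b) instr \<Rightarrow> bool" where
  "first_carry (Inc r) \<longleftrightarrow> True"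
| "first_carry i \<longleftrightarrow> False"

fun verdict :: "('r, 'a, 'b) instr \<Rightarrow> bool \<Rightarrow> bool" where
  "verdict (Neq r r') y \<longleftrightarrow> y"
| "verdict i y \<longleftrightarrow> True"

fun sweep :: "('r, 'a, 'b) instr \<Rightarrow> bool \<Rightarrow> 'r set list \<Rightarrow> 'r set list" where
  "sweep i y [] = overflow i y"
| "sweep i y (v # vs) = digit i y v # sweep i (carry i y v) vs"

fun sweep_carry :: "('r, 'a, 'b) instr \<Rightarrow> bool \<Rightarrow> 'r set list \<Rightarrow> bool" where
  "sweep_carry i y [] = y"
| "sweep_carry i y (v # vs) = sweep_carry i (carry i y v) vs"

fun val :: "'r \<Rightarrow> 'r set list \<Rightarrow> nat" where
  "val r [] = 0"
| "val r (v # vs) = of_bool (r \<in> v) + 2 * val r vs"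

lemma val_sweep_Inc: "val q (sweep (Inc r) y vs) = val q vs + of_bool (y \<and> q = r)"
  by (induction vs arbitrary: y) (auto simp: of_bool_def)

lemma val_sweep_Zero: "val q (sweep (Zero r) y vs) = (if q = r then 0 else val q vs)"
  by (induction vs arbitrary: y) auto

lemma sweep_Neq: "sweep (Neq r r') y vs = vs"
  by (induction vs arbitrary: y) auto

lemma sweep_carry_Neq: "sweep_carry (Neq r r') y vs \<longleftrightarrow> y \<or> val r vs \<noteq> val r' vs"
proof (induction vs arbitrary: y)
  case (Cons v vs)
  have "of_bool P + 2 * a = of_bool Q + 2 * b \<longleftrightarrow> P = Q \<and> a = b" for P Q and a b :: nat
    by (cases P; cases Q) (auto, presburger+)
  then show ?case using Cons by auto
qed simp

lemma length_sweep_Zero: "length (sweep (Zero r) y vs) = length vs"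
  by (induction vs arbitrary: y) auto

text \<open>A carry leaves the top column only if all digits of \<open>r\<close> were 1, that is, if
  the new value is 2 to the old length. The maximum appears because leading zero columns are never
  removed.\<close>

lemma length_sweep_Inc:
  "2 ^ length (sweep (Inc r) y vs) \<le> max (2 ^ length vs) (2 * (val r vs + of_bool y))"
proof (induction vs arbitrary: y)
  case (Cons v vs)
  from Cons[of "carry (Inc r) y v"] show ?case by (cases y; cases "r \<in> v") auto
qed auto

text \<open>Every idle step writes \<open>Mark\<close> into the scanned cell, which is cell 0. This
  also installs the end marker on the blank initial tape.\<close>

fun mdelta :: "('r, 'a, 'b) com \<times> phase \<Rightarrow> 'a input_symbol \<Rightarrow> 'r cell \<Rightarrow>
    (('r, 'a, 'b) com \<times> phase) \<times> 'r cell \<times> direction \<times> direction \<times> 'b option" where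
  "mdelta (c, Idle) x s = (case head c of
      Go d \<Rightarrow> ((cont c True, Idle), Mark, d, Stay, None)
    | Put b \<Rightarrow> ((cont c True, Idle), Mark, Stay, Stay, Some b)
    | Sym P \<Rightarrow> ((cont c (P x), Idle), Mark, Stay, Stay, None)
    | i \<Rightarrow> ((c, Fwd (first_carry i)), Mark, Stay, Move_Right, None))"
| "mdelta (c, Fwd y) x s = (case s of
      Col v \<Rightarrow> ((c, Fwd (carry (head c) y v)), Col (digit (head c) y v), Stay, Move_Right, None)
    | _ \<Rightarrow> ((c, Bwd y), (case overflow (head c) y of [] \<Rightarrow> Blank | v # _ \<Rightarrow> Col v),
        Stay, Move_Left, None))"
| "mdelta (c, Bwd y) x s = (case s of
      Col v \<Rightarrow> ((c, Bwd y), Col v, Stay, Move_Left, None)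
    | _ \<Rightarrow> ((cont c (verdict (head c) y), Idle), Mark, Stay, Stay, None))"

text \<open>Finite although loops unroll: the body of a loop is always followed by the same loop, so
  unrolling twice produces nothing new.\<close>

fun residuals :: "('r, 'a, 'b) com \<Rightarrow> ('r, 'a, 'b) com set" where
  "residuals Skip = {Skip}"
| "residuals (Prim i) = {Prim i, Skip}"
| "residuals (Seq c d) = (\<lambda>c'. c' ;; d) ` residuals c \<union> residuals d"
| "residuals (Cond i c d) = {Cond i c d} \<union> residuals c \<union> residuals d"
| "residuals (While i c) = {While i c, Skip} \<union> (\<lambda>c'. c' ;; While i c) ` residuals c"

lemma finite_residuals: "finite (residuals c)"
  by (induction c) auto

lemma residuals_refl: "c \<in> residuals c"
  by (induction c) auto

lemma Skip_in_residuals: "Skip \<in> residuals c"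
  by (induction c) auto

lemma cont_in_residuals: "c' \<in> residuals c \<Longrightarrow> cont c' y \<in> residuals c"
  by (induction c arbitrary: c') (auto simp: residuals_refl split: if_splits)

text \<open>Only \<open>Inc\<close> can insert a register into a column, so this keeps the tape
  alphabet inside \<open>Pow R\<close>.\<close>

fun instr_in :: "'r set \<Rightarrow> 'b set \<Rightarrow> ('r, 'a, 'b) instr \<Rightarrow> bool" where
  "instr_in R B (Inc r) \<longleftrightarrow> r \<in> R"
| "instr_in R B (Put b) \<longleftrightarrow> b \<in> B"
| "instr_in R B i \<longleftrightarrow> True"

fun com_in :: "'r set \<Rightarrow> 'b set \<Rightarrow> ('r, 'a, 'b) com \<Rightarrow> bool" where
  "com_in R B Skip \<longleftrightarrow> True"
| "com_in R B (Prim i) \<longleftrightarrow> instr_in R B i"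
| "com_in R B (Seq c d) \<longleftrightarrow> com_in R B c \<and> com_in R B d"
| "com_in R B (Cond i c d) \<longleftrightarrow> instr_in R B i \<and> com_in R B c \<and> com_in R B d"
| "com_in R B (While i c) \<longleftrightarrow> instr_in R B i \<and> com_in R B c"

lemma com_in_residuals: "c' \<in> residuals c \<Longrightarrow> com_in R B c \<Longrightarrow> com_in R B c'"
  by (induction c arbitrary: c') auto

lemma instr_in_head: "com_in R B c \<Longrightarrow> instr_in R B (head c)"
  by (induction c) auto

definition compile :: "'r set \<Rightarrow> ('r, 'a, 'b) com \<Rightarrow>
    (('r, 'a, 'b) com \<times> phase, 'r cell, 'a, 'b) transducer" where
  "compile R p = \<lparr>states = residuals p \<times> insert Idle (range Fwd \<union> range Bwd),
    start = (p, Idle), halt = (Skip, Idle), work_symbols = {Blank, Mark} \<union> Col ` Pow R,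
    blank = Blank, delta = mdelta\<rparr>"

lemma compile_simps [simp]:
  "delta (compile R p) = mdelta" "halt (compile R p) = (Skip, Idle)"
  "start (compile R p) = (p, Idle)" "blank (compile R p) = Blank"
  by (simp_all add: compile_def)

lemma overflow_cases: "overflow i y = [] \<or> (\<exists>v. overflow i y = [v])"
  by (cases i) auto

lemma transducer_compile:
  assumes "finite A" "finite B" "finite R" "com_in R B p"
  shows "transducer A B (compile R p)"
proof -
  let ?Q = "residuals p \<times> insert Idle (range Fwd \<union> range Bwd)"
  let ?G = "{Blank, Mark} \<union> Col ` Pow R"
  have Q: "states (compile R p) = ?Q" and G: "work_symbols (compile R p) = ?G"
    by (simp_all add: compile_def)
  have closed: "case mdelta q x s of (q', s', _, _, y) \<Rightarrow> q' \<in> ?Q \<and> s' \<in> ?G \<and> set_option y \<subseteq> B"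
    if q: "q \<in> ?Q" and s: "s \<in> ?G" for q x s
  proof -
    obtain c ph where c: "q = (c, ph)" "c \<in> residuals p" using q by auto
    have i: "instr_in R B (head c)"
      using com_in_residuals[OF c(2) assms(4)] by (rule instr_in_head)
    note r = cont_in_residuals[OF c(2)]
    show ?thesis
    proof (cases ph)
      case Idle
      then show ?thesis using c i r by (cases "head c") auto
    next
      case (Fwd y)
      have o: "overflow (head c) y = [] \<or> (\<exists>r\<in>R. overflow (head c) y = [{r}])"
        using i by (cases "head c") auto
      show ?thesis
      proof (cases s)
        case (Col v)
        then have "digit (head c) y v \<subseteq> R" using i s by (cases "head c") auto
        then show ?thesis using c(2) unfolding c(1) Fwd Col by simp
      qed (use c o in \<open>auto simp: Fwd\<close>)
    next
      case (Bwd y)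
      then show ?thesis using c(2) r s unfolding c(1) by (cases s) auto
    qed
  qed
  show ?thesis
    unfolding transducer_def Q G compile_simps
  proof (intro conjI ballI)
    have "finite (UNIV :: bool set)" by simp
    then show "finite ?Q" by (intro finite_cartesian_product finite_residuals) simp
  next
    fix q x s assume "q \<in> ?Q" "s \<in> ?G"
    then show "case mdelta q x s of (q', s', _, _, y) \<Rightarrow> q' \<in> ?Q \<and> s' \<in> ?G \<and> set_option y \<subseteq> B"
      by (rule closed)
  qed (use assms residuals_refl[of p] Skip_in_residuals[of p] in simp_all)
qed

section \<open>Simulation of program steps by sweeps over the work tape\<close>

definition reaches :: "('q, 's, 'a, 'b) transducer \<Rightarrow> 'a list \<Rightarrow> nat \<Rightarrow>
    ('q, 's, 'b) config \<Rightarrow> ('q, 's, 'b) config \<Rightarrow> bool" where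
  "reaches T w S c c' \<longleftrightarrow>
    (\<exists>k. (step T w ^^ k) c = c' \<and> (\<forall>j\<le>k. work_pos ((step T w ^^ j) c) < S))"

lemma reaches_refl: "work_pos c < S \<Longrightarrow> reaches T w S c c"
  unfolding reaches_def by (intro exI[of _ 0]) simp

lemma reaches_step:
  assumes "work_pos c < S" "reaches T w S (step T w c) c'"
  shows "reaches T w S c c'"
proof -
  obtain k where k: "(step T w ^^ k) (step T w c) = c'"
    "\<forall>j\<le>k. work_pos ((step T w ^^ j) (step T w c)) < S"
    using assms(2) unfolding reaches_def by blast
  have "work_pos ((step T w ^^ j) c) < S" if "j \<le> Suc k" for j
    using that k(2) assms(1) by (cases j) (auto simp: funpow_swap1)
  moreover have "(step T w ^^ Suc k) c = c'" using k(1) by (simp add: funpow_swap1)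
  ultimately show ?thesis unfolding reaches_def by blast
qed

lemma reaches_trans:
  assumes "reaches T w S c c'" "reaches T w S c' c''"
  shows "reaches T w S c c''"
proof -
  obtain k where k: "(step T w ^^ k) c = c'" "\<forall>j\<le>k. work_pos ((step T w ^^ j) c) < S"
    using assms(1) unfolding reaches_def by blast
  then show ?thesis
  proof (induction k arbitrary: c)
    case 0
    then show ?case using assms(2) by simp
  next
    case (Suc k)
    have "reaches T w S (step T w c) c''"
    proof (rule Suc.IH)
      show "(step T w ^^ k) (step T w c) = c'" using Suc.prems(1) by (simp add: funpow_swap1)
      show "\<forall>j\<le>k. work_pos ((step T w ^^ j) (step T w c)) < S"
      proof (intro allI impI)
        fix j assume "j \<le> k"
        then have "work_pos ((step T w ^^ Suc j) c) < S" using Suc.prems(2) by blast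
        then show "work_pos ((step T w ^^ j) (step T w c)) < S" by (simp add: funpow_swap1)
      qed
    qed
    moreover have "work_pos c < S" using Suc.prems(2) by force
    ultimately show ?case by (rule reaches_step[rotated])
  qed
qed

definition tape_of :: "'r set list \<Rightarrow> nat \<Rightarrow> 'r cell" where
  "tape_of cols p =
    (if p = 0 then Mark else if p \<le> length cols then Col (cols ! (p - 1)) else Blank)"

lemma tape_of_0: "tape_of cols 0 = Mark"
  by (simp add: tape_of_def)

lemma tape_of_at: "tape_of (us @ v # vs) (Suc (length us)) = Col v"
  by (simp add: tape_of_def)

lemma tape_of_end: "tape_of us (Suc (length us)) = Blank"
  by (simp add: tape_of_def)

lemma tape_of_upd:
  "(tape_of (us @ v # vs))(Suc (length us) := Col v') = tape_of (us @ v' # vs)"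
  by (auto simp: tape_of_def fun_eq_iff nth_append nth_Cons split: nat.splits)

lemma tape_of_upd_Blank: "(tape_of us)(Suc (length us) := Blank) = tape_of us"
  by (auto simp: tape_of_def fun_eq_iff)

lemma tape_of_upd_snoc: "(tape_of us)(Suc (length us) := Col v) = tape_of (us @ [v])"
  by (auto simp: tape_of_def fun_eq_iff nth_append)

abbreviation (input) conf ::
  "'q \<Rightarrow> nat \<Rightarrow> (nat \<Rightarrow> 's) \<Rightarrow> nat \<Rightarrow> 'b list \<Rightarrow> ('q, 's, 'b) config" where
  "conf q ip tp wp ow \<equiv>
    \<lparr>state = q, input_pos = ip, work_tape = tp, work_pos = wp, output_word = ow\<rparr>"

lemma step_Fwd_Col:
  assumes "ip \<le> length w + 1" "tp wp = Col v"
  shows "step (compile R p) w (conf (c, Fwd y) ip tp wp ow) =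
    conf (c, Fwd (carry (head c) y v)) ip (tp(wp := Col (digit (head c) y v))) (Suc wp) ow"
  using assms by (simp add: step_def)

lemma step_Fwd_Blank:
  assumes "ip \<le> length w + 1" "tp (Suc wp) = Blank"
  shows "step (compile R p) w (conf (c, Fwd y) ip tp (Suc wp) ow) =
    conf (c, Bwd y) ip
      (tp(Suc wp := (case overflow (head c) y of [] \<Rightarrow> Blank | v # _ \<Rightarrow> Col v))) wp ow"
  using assms by (simp add: step_def)

lemma step_Bwd_Col:
  assumes "ip \<le> length w + 1" "tp (Suc wp) = Col v"
  shows "step (compile R p) w (conf (c, Bwd y) ip tp (Suc wp) ow) = conf (c, Bwd y) ip tp wp ow"
  using assms by (simp add: step_def fun_upd_idem)

lemma step_Bwd_Mark:
  assumes "ip \<le> length w + 1" "tp 0 = Mark"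
  shows "step (compile R p) w (conf (c, Bwd y) ip tp 0 ow) =
    conf (cont c (verdict (head c) y), Idle) ip tp 0 ow"
  using assms by (simp add: step_def fun_upd_idem)

text \<open>The columns \<open>us\<close> are already rewritten, and the head stands on the first
  column of \<open>vs\<close>. It turns round at the first blank, where a surviving carry opens one
  more column.\<close>

lemma sweep_right:
  assumes "length us + length vs + 1 < S" "ip \<le> length w + 1"
  shows "reaches (compile R p) w S
    (conf (c, Fwd y) ip (tape_of (us @ vs)) (Suc (length us)) ow)
    (conf (c, Bwd (sweep_carry (head c) y vs)) ip (tape_of (us @ sweep (head c) y vs))
      (length us + length vs) ow)"
  using assms(1)
proof (induction vs arbitrary: us y)
  case Nil
  have "(tape_of us)(Suc (length us) := (case overflow (head c) y of [] \<Rightarrow> Blank | v # _ \<Rightarrow> Col v))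
      = tape_of (us @ overflow (head c) y)"
    using overflow_cases[of "head c" y] tape_of_upd_Blank tape_of_upd_snoc by auto
  then show ?case
    using Nil step_Fwd_Blank[where tp = "tape_of us", OF assms(2) tape_of_end, of R p c y ow]
    by - (rule reaches_step, simp_all add: reaches_refl)
next
  case (Cons v vs)
  show ?case
  proof (rule reaches_step)
    show "reaches (compile R p) w S (step (compile R p) w
        (conf (c, Fwd y) ip (tape_of (us @ v # vs)) (Suc (length us)) ow))
      (conf (c, Bwd (sweep_carry (head c) y (v # vs))) ip
        (tape_of (us @ sweep (head c) y (v # vs))) (length us + length (v # vs)) ow)"
      using Cons.IH[of "us @ [digit (head c) y v]" "carry (head c) y v"] Cons.prems
      unfolding step_Fwd_Col[where tp = "tape_of (us @ v # vs)", OF assms(2) tape_of_at] tape_of_upd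
      by simp
  qed (use Cons.prems in simp)
qed

lemma sweep_left:
  assumes "wp \<le> length cols" "wp < S" "ip \<le> length w + 1"
  shows "reaches (compile R p) w S (conf (c, Bwd y) ip (tape_of cols) wp ow)
    (conf (cont c (verdict (head c) y), Idle) ip (tape_of cols) 0 ow)"
  using assms(1,2)
proof (induction wp)
  case 0
  show ?case
    by (rule reaches_step) (use 0 in \<open>simp_all add: step_Bwd_Mark[OF assms(3)] tape_of_0 reaches_refl\<close>)
next
  case (Suc wp)
  have "tape_of cols (Suc wp) = Col (cols ! wp)" using Suc.prems by (simp add: tape_of_def)
  then show ?case
    by - (rule reaches_step, use Suc in \<open>simp_all add: step_Bwd_Col[OF assms(3)]\<close>)
qed

text \<open>Cell 0 is overwritten before comparing because it is still blank in the initial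
  configuration. The last conjunct is what \<open>length_sweep_Inc\<close> preserves while counters
  stay at most \<open>b\<close>.\<close>

definition represents :: "'a list \<Rightarrow> nat \<Rightarrow> (('r, 'a, 'b) com \<times> phase, 'r cell, 'b) config \<Rightarrow>
    ('r, 'a, 'b) com \<Rightarrow> ('r, 'b) store \<Rightarrow> bool" where
  "represents w b cf c s \<longleftrightarrow> state cf = (c, Idle) \<and> input_pos cf = pos s \<and> pos s \<le> length w + 1 \<and>
    output_word cf = out s \<and> work_pos cf = 0 \<and>
    (\<exists>cols. (work_tape cf)(0 := Mark) = tape_of cols \<and> reg s = (\<lambda>r. val r cols) \<and>
      2 ^ length cols \<le> 2 * b)"

text \<open>With \<open>l\<close> columns on the tape, a sweep goes as far as the blank in cell
  \<open>l + 1\<close>; hence the form of the assumption on \<open>S\<close>.\<close>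

lemma simulate_step:
  assumes rep: "represents w b cf c s" and c: "c \<noteq> Skip" "fits b (head c) s"
    and S: "\<And>l :: nat. 2 ^ l \<le> 2 * b \<Longrightarrow> l + 1 < S"
  shows "\<exists>cf'. reaches (compile R p) w S cf cf' \<and>
    represents w b cf' (cont c (outcome w (head c) s)) (effect w (head c) s)"
proof -
  obtain cols where cols: "(work_tape cf)(0 := Mark) = tape_of cols" "reg s = (\<lambda>r. val r cols)"
      "2 ^ length cols \<le> 2 * b"
    using rep unfolding represents_def by blast
  have cf: "state cf = (c, Idle)" "input_pos cf = pos s" "pos s \<le> length w + 1"
      "output_word cf = out s" "work_pos cf = 0"
    using rep by (auto simp: represents_def)
  have Sl: "length cols + 1 < S" using S cols(3) .
  have m0: "(tape_of cols)(0 := Mark) = tape_of cols" by (simp add: tape_of_def fun_eq_iff)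
  let ?T = "compile R p"
  have immediate: ?thesis
    if "represents w b (step ?T w cf) (cont c (outcome w (head c) s)) (effect w (head c) s)"
  proof (intro exI conjI)
    show "reaches ?T w S cf (step ?T w cf)"
      by (rule reaches_step[OF _ reaches_refl])
        (use that cf Sl in \<open>auto simp: represents_def\<close>)
  qed (rule that)
  have swept: ?thesis
    if i: "step ?T w cf = \<lparr>state = (c, Fwd (first_carry (head c))), input_pos = pos s,
        work_tape = tape_of cols, work_pos = 1, output_word = out s\<rparr>"
      and e: "effect w (head c) s
        = s\<lparr>reg := \<lambda>r. val r (sweep (head c) (first_carry (head c)) cols)\<rparr>"
      and v: "verdict (head c) (sweep_carry (head c) (first_carry (head c)) cols)
        = outcome w (head c) s"
      and l: "length cols \<le> length (sweep (head c) (first_carry (head c)) cols)"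
        "2 ^ length (sweep (head c) (first_carry (head c)) cols) \<le> 2 * b"
  proof (intro exI conjI)
    let ?cols = "sweep (head c) (first_carry (head c)) cols"
    let ?cf = "\<lparr>state = (cont c (outcome w (head c) s), Idle), input_pos = pos s,
      work_tape = tape_of ?cols, work_pos = 0, output_word = out s\<rparr>"
    show "represents w b ?cf (cont c (outcome w (head c) s)) (effect w (head c) s)"
      unfolding represents_def e
      using cf l by (auto intro!: exI[of _ ?cols] simp: tape_of_def fun_eq_iff)
    have "reaches ?T w S (step ?T w cf)
      \<lparr>state = (c, Bwd (sweep_carry (head c) (first_carry (head c)) cols)), input_pos = pos s,
        work_tape = tape_of ?cols, work_pos = length cols, output_word = out s\<rparr>"
      unfolding i using sweep_right[of "[]" cols S "pos s" w] Sl cf(3) by simp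
    moreover have "reaches ?T w S
      \<lparr>state = (c, Bwd (sweep_carry (head c) (first_carry (head c)) cols)), input_pos = pos s,
        work_tape = tape_of ?cols, work_pos = length cols, output_word = out s\<rparr> ?cf"
      unfolding v[symmetric] by (rule sweep_left) (use l Sl cf(3) in auto)
    ultimately show "reaches ?T w S cf ?cf"
      using cf(5) Sl by (auto intro: reaches_step[OF _ reaches_trans])
  qed
  show ?thesis
  proof (cases "head c")
    case (Inc r)
    \<comment> \<open>Here \<open>fits\<close> enters: the old value is below \<open>b\<close>, so
      the new one is at most \<open>b\<close>.\<close>
    have "max (2 ^ length cols) (2 * (val r cols + of_bool True)) \<le> 2 * b"
      using c(2) cols(2,3) Inc by simp
    with length_sweep_Inc have "2 ^ length (sweep (Inc r) True cols) \<le> 2 * b"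
      by (rule order_trans)
    moreover have "length cols \<le> length (sweep (Inc r) y cols)" for y
      by (induction cols arbitrary: y) auto
    ultimately show ?thesis using Inc c(1) cf cols
      by (intro swept) (auto simp: step_def val_sweep_Inc fun_eq_iff min_absorb1)
  next
    case (Zero r)
    then show ?thesis using c(1) cf cols
      by (intro swept) (auto simp: step_def val_sweep_Zero length_sweep_Zero fun_eq_iff min_absorb1)
  next
    case (Neq r r')
    then show ?thesis using c(1) cf cols
      by (intro swept) (auto simp: step_def sweep_Neq sweep_carry_Neq min_absorb1)
  next
    case (Go d)
    then show ?thesis using c(1) cf cols m0
      by (intro immediate) (auto simp: step_def represents_def)
  next
    case (Put x)
    then show ?thesis using c(1) cf cols m0
      by (intro immediate) (auto simp: step_def represents_def)
  next
    case (Sym P)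
    then show ?thesis using c(1) cf cols m0
      by (intro immediate) (auto simp: step_def represents_def)
  qed
qed

lemma simulate:
  assumes "((c, s), (c', s')) \<in> (small w b)\<^sup>*" "represents w b cf c s"
    and S: "\<And>l :: nat. 2 ^ l \<le> 2 * b \<Longrightarrow> l + 1 < S"
  shows "\<exists>cf'. reaches (compile R p) w S cf cf' \<and> represents w b cf' c' s'"
  using assms(1)
proof (induction rule: rtrancl_induct2)
  case refl
  have "work_pos cf < S"
    using assms(2) S by (fastforce simp: represents_def)
  then show ?case using assms(2) reaches_refl by blast
next
  case (step c1 s1 c2 s2)
  then obtain cf1 where cf1: "reaches (compile R p) w S cf cf1" "represents w b cf1 c1 s1" by blast
  obtain cf2 where "reaches (compile R p) w S cf1 cf2" "represents w b cf2 c2 s2"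
    using simulate_step[OF cf1(2) _ _ S] step.hyps(2) by (auto simp: small_def)
  then show ?case using cf1(1) reaches_trans by blast
qed

lemma compile_run:
  assumes "exec w b p \<lparr>reg = \<lambda>_. 0, pos = 0, out = []\<rparr> s'" "b \<ge> 1"
    and S: "\<And>l :: nat. 2 ^ l \<le> 2 * b \<Longrightarrow> l + 1 < S"
  shows "computes (compile R p) w (out s')" and "work_pos (run (compile R p) w t) < S"
proof -
  let ?T = "compile R p"
  have "represents w b (initial_config ?T) p \<lparr>reg = \<lambda>_. 0, pos = 0, out = []\<rparr>"
    using assms(2) by (auto simp: represents_def initial_config_def tape_of_def fun_eq_iff
        intro!: exI[of _ "[]"])
  then obtain cf where cf: "reaches ?T w S (initial_config ?T) cf" "represents w b cf Skip s'"
    using simulate[OF _ _ S] assms(1) unfolding exec_def by blast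
  obtain k where k: "run ?T w k = cf" "\<forall>j\<le>k. work_pos (run ?T w j) < S"
    using cf(1) unfolding reaches_def run_def by blast
  show "computes ?T w (out s')"
    using cf(2) k(1) unfolding computes_def by (auto simp: represents_def)
  have "run ?T w (k + j) = cf" for j
  proof (induction j)
    case (Suc j)
    then show ?case using cf(2) by (simp add: run_Suc step_def represents_def)
  qed (simp add: k(1))
  then have "work_pos (run ?T w t) < S" if "k \<le> t"
    using that k by (metis le_add_diff_inverse order_refl)
  then show "work_pos (run ?T w t) < S" using k(2) by (cases "t \<le> k") auto
qed

lemma log_linear_bigo:
  assumes "C \<ge> (1 :: real)"
  shows "(\<lambda>m. real (nat \<lfloor>log 2 (C * (real m + 1))\<rfloor> + 2)) \<in> O(\<lambda>m. ln (real m))"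
proof (rule bigoI)
  show "\<forall>\<^sub>F m in sequentially. norm (real (nat \<lfloor>log 2 (C * (real m + 1))\<rfloor> + 2))
    \<le> ((ln C + 2) / ln 2 + 2) * norm (ln (real m))"
  \<comment> \<open>From 3 on, \<open>ln m\<close> is at least 1 because e is at most 3, so additive
    constants are absorbed into multiples of it.\<close>
  proof (rule eventually_sequentiallyI[of 3])
    fix m :: nat assume m: "3 \<le> m"
    have "exp 1 \<le> real m" using m exp_le by linarith
    then have l: "1 \<le> ln (real m)" using m by (simp add: ln_ge_iff)
    have "3 * real m \<le> real m * real m" using m by (intro mult_right_mono) auto
    then have "real m + 1 \<le> real m * real m" using m by linarith
    then have "ln (real m + 1) \<le> ln (real m * real m)" using m by (subst ln_le_cancel_iff) auto
    then have l1: "ln (real m + 1) \<le> 2 * ln (real m)" using m by (simp add: ln_mult)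
    have C0: "0 \<le> ln C" using assms by simp
    have "ln (C * (real m + 1)) = ln C + ln (real m + 1)" using assms by (intro ln_mult_pos) auto
    also have "\<dots> \<le> ln C * ln (real m) + 2 * ln (real m)"
      using l1 mult_left_mono[OF l C0] by simp
    finally have "log 2 (C * (real m + 1)) \<le> (ln C + 2) / ln 2 * ln (real m)"
      by (simp add: log_def divide_right_mono algebra_simps)
    moreover have "0 \<le> log 2 (C * (real m + 1))"
    proof -
      have "1 * 1 \<le> C * (real m + 1)" using assms by (intro mult_mono) auto
      then show ?thesis by simp
    qed
    then have "real (nat \<lfloor>log 2 (C * (real m + 1))\<rfloor>) \<le> log 2 (C * (real m + 1))" by simp
    ultimately show "norm (real (nat \<lfloor>log 2 (C * (real m + 1))\<rfloor> + 2))
        \<le> ((ln C + 2) / ln 2 + 2) * norm (ln (real m))"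
      using l by (simp add: algebra_simps)
  qed
qed

theorem logspace_program:
  fixes p :: "('r, 'a, 'b) com"
  assumes "finite A" "finite B" "finite R" "com_in R B p" "K \<ge> 1"
    and "\<And>w. w \<in> lists A \<Longrightarrow>
      \<exists>s'. exec w (K * (length w + 1)) p \<lparr>reg = \<lambda>_. 0, pos = 0, out = []\<rparr> s' \<and> out s' = F w"
  shows "\<exists>T :: (nat, nat, 'a, 'b) transducer.
    logspace_transducer A B T \<and> (\<forall>w\<in>lists A. computes T w (F w))"
proof -
  define T where "T = compile R p"
  \<comment> \<open>The logarithm bounds the number \<open>l\<close> of columns, from 2 ^ l being at
    most twice the counter bound; adding 2 makes \<open>l + 1\<close> strictly smaller.\<close>
  define S where "S = (\<lambda>m. nat \<lfloor>log 2 (real (2 * K) * (real m + 1))\<rfloor> + 2)"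
  have "transducer A B T" unfolding T_def by (intro transducer_compile assms)
  then obtain T' :: "(nat, nat, 'a, 'b) transducer" where T': "transducer A B T'"
    "\<And>w t. w \<in> lists A \<Longrightarrow> work_pos (run T' w t) = work_pos (run T w t) \<and>
      output_word (run T' w t) = output_word (run T w t) \<and>
      (state (run T' w t) = halt T' \<longleftrightarrow> state (run T w t) = halt T)"
    using transducer_nat by blast
  have *: "computes T w (F w) \<and> (\<forall>t. work_pos (run T w t) < S (length w))"
    if w: "w \<in> lists A" for w
  proof -
    let ?b = "K * (length w + 1)"
    obtain s' where s': "exec w ?b p \<lparr>reg = \<lambda>_. 0, pos = 0, out = []\<rparr> s'" "out s' = F w"
      using assms(6)[OF w] by blast
    have b: "1 \<le> ?b" using assms(5) by simp
    have S: "l + 1 < S (length w)" if "2 ^ l \<le> 2 * ?b" for l :: nat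
    proof -
      have "real (2 ^ l) \<le> real (2 * ?b)" using that by (rule of_nat_mono)
      then have "2 powr real l \<le> real (2 * K) * (real (length w) + 1)"
        by (simp add: powr_realpow algebra_simps)
      then have "real l \<le> log 2 (real (2 * K) * (real (length w) + 1))"
        using assms(5) by (subst le_log_iff) auto
      then have "int l \<le> \<lfloor>log 2 (real (2 * K) * (real (length w) + 1))\<rfloor>"
        by (simp add: le_floor_iff)
      then show ?thesis unfolding S_def by linarith
    qed
    show ?thesis
      unfolding T_def s'(2)[symmetric] using compile_run[OF s'(1) b S] by (intro conjI allI)
  qed
  have "logspace_transducer A B T'"
    unfolding logspace_transducer_def
  proof (intro conjI exI[of _ S])
    show "(\<lambda>m. real (S m)) \<in> O(\<lambda>m. ln (real m))"
      unfolding S_def using assms(5) by (intro log_linear_bigo) auto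
    show "\<forall>w\<in>lists A. \<forall>t. work_pos (run T' w t) < S (length w)"
      using * T'(2) by simp
  qed (rule T')
  moreover have "computes T' w (F w)" if w: "w \<in> lists A" for w
  proof -
    obtain t where "state (run T w t) = halt T" "output_word (run T w t) = F w"
      using *[OF w] unfolding computes_def by blast
    then show ?thesis
      unfolding computes_def using T'(2)[OF w, of t] by (intro exI[of _ t]) simp
  qed
  ultimately show ?thesis by blast
qed


section \<open>Integers divisible by all small numbers\<close>

text \<open>
  Leibniz's harmonic triangle: \<open>1 / ((n + 1) (n choose j))\<close> is the difference of an entry of the
  previous row and a neighbour, hence an integral combination of \<open>1, 1/2, \<dots>, 1/(n + 1)\<close>.
\<close>

lemma leibniz_triangle_dvd:
  fixes x :: int
  assumes "\<And>m. 1 \<le> m \<Longrightarrow> m \<le> K \<Longrightarrow> int m dvd x" "n < K" "j \<le> n"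
  shows "int ((n + 1) * (n choose j)) dvd x"
  using assms(2,3)
proof (induction j arbitrary: n)
  case 0
  then show ?case using assms(1)[of "n + 1"] by simp
next
  case (Suc j)
  then obtain n' where n: "n = Suc n'" by (cases n) auto
  define a where "a = int n * int (n' choose j)"
  define b where "b = int (n + 1) * int (n choose j)"
  define d where "d = int (n + 1) * int (n choose Suc j)"
  have "a dvd x" using Suc.IH[of n'] Suc.prems n by (simp add: a_def algebra_simps)
  moreover have "b dvd x" using Suc.IH[of n] Suc.prems by (simp add: b_def algebra_simps)
  ultimately obtain p q where p: "x = a * p" and q: "x = b * q" unfolding dvd_def by blast
  have "int (Suc n') * int (n' choose j) = int (Suc n' choose Suc j) * int (Suc j)"
    using Suc_times_binomial_eq[of n' j] by (metis of_nat_mult)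
  then have da: "int (Suc j) * d = int (n + 1) * a"
    by (simp add: d_def a_def n)
  have "int (n - j) * int (n choose j) = int n * int (n' choose j)"
    using binomial_absorb_comp[of n j] n by (metis of_nat_mult diff_Suc_1)
  then have ba: "int (n - j) * b = int (n + 1) * a"
    by (simp add: b_def a_def algebra_simps)
  \<comment> \<open>The recurrence 1/d = 1/a - 1/b of the triangle, cleared of denominators:
    \<open>a\<close> is from the previous row, \<open>b\<close> is the neighbour in the same
    row.\<close>
  have "int (Suc j) * (d * (p - q)) = int (n + 1) * a * p - int (n - j) * b * q"
    unfolding ba by (simp only: mult.assoc[symmetric] da right_diff_distrib)
  also have "\<dots> = (int (n + 1) - int (n - j)) * x"
    by (simp add: left_diff_distrib mult.assoc flip: p q)
  also have "int (n + 1) - int (n - j) = int (Suc j)" using Suc.prems by simp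
  finally have "x = d * (p - q)" by (simp del: of_nat_Suc)
  then have "d dvd x" by (rule dvdI)
  moreover have "int ((n + 1) * (n choose Suc j)) = d" unfolding d_def by (rule of_nat_mult)
  ultimately show ?case by simp
qed

text \<open>The middle entry of row 2k of the triangle gives the divisor (2k + 1) (2k choose k) of
  \<open>x\<close>. It is at least 4 ^ k, since the central binomial coefficient is the largest of
  2k + 1 numbers with sum 4 ^ k.\<close>

lemma zero_if_small_divisors:
  fixes x :: int
  assumes "\<And>m. 1 \<le> m \<Longrightarrow> m \<le> 2 * k + 1 \<Longrightarrow> int m dvd x" "\<bar>x\<bar> < 4 ^ k"
  shows "x = 0"
proof (rule ccontr)
  assume x: "x \<noteq> 0"
  have "(4 :: nat) ^ k = (\<Sum>j\<le>2 * k. (2 * k) choose j)"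
    by (simp add: choose_row_sum power_mult)
  also have "\<dots> \<le> (\<Sum>j\<le>2 * k. (2 * k) choose k)" by (intro sum_mono binomial_maximum')
  finally have "4 ^ k \<le> (2 * k + 1) * ((2 * k) choose k)" by simp
  then have "(4 :: int) ^ k \<le> int ((2 * k + 1) * ((2 * k) choose k))"
    by (metis of_nat_mono of_nat_numeral of_nat_power)
  moreover have "int ((2 * k + 1) * ((2 * k) choose k)) dvd x"
    by (rule leibniz_triangle_dvd[OF assms(1)]) auto
  ultimately show False using dvd_imp_le_int[OF x] assms(2) by fastforce
qed


section \<open>Total correctness of while programs\<close>

text \<open>Programs are deterministic, so the existence of a finished run is total correctness;
  through \<open>exec\<close> it also asserts that all increments respect \<open>b\<close>.\<close>

definition hoare :: "'a list \<Rightarrow> nat \<Rightarrow> (('r, 'b) store \<Rightarrow> bool) \<Rightarrow> ('r, 'a, 'b) com \<Rightarrow>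
    (('r, 'b) store \<Rightarrow> bool) \<Rightarrow> bool" where
  "hoare w b P c Q \<longleftrightarrow> (\<forall>s. P s \<longrightarrow> (\<exists>s'. exec w b c s s' \<and> Q s'))"

lemma hoare_Skip: "(\<And>s. P s \<Longrightarrow> Q s) \<Longrightarrow> hoare w b P Skip Q"
  unfolding hoare_def using exec_Skip by blast

lemma hoare_Prim:
  "(\<And>s. P s \<Longrightarrow> fits b i s) \<Longrightarrow> (\<And>s. P s \<Longrightarrow> Q (effect w i s)) \<Longrightarrow> hoare w b P (Prim i) Q"
  unfolding hoare_def using exec_Prim by blast

lemma hoare_Seq: "hoare w b P c Q \<Longrightarrow> hoare w b Q d R \<Longrightarrow> hoare w b P (c ;; d) R"
  unfolding hoare_def using exec_Seq by blast

lemma hoare_conseq: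
  "hoare w b P c Q \<Longrightarrow> (\<And>s. P' s \<Longrightarrow> P s) \<Longrightarrow> (\<And>s. Q s \<Longrightarrow> Q' s) \<Longrightarrow> hoare w b P' c Q'"
  unfolding hoare_def by blast

fun is_test :: "('r, 'a, 'b) instr \<Rightarrow> bool" where
  "is_test (Neq r r') \<longleftrightarrow> True"
| "is_test (Sym P) \<longleftrightarrow> True"
| "is_test i \<longleftrightarrow> False"

lemma is_test: "is_test i \<Longrightarrow> fits b i s \<and> effect w i s = s"
  by (cases i) auto

lemma hoare_Cond:
  assumes "is_test i" "hoare w b (\<lambda>s. P s \<and> outcome w i s) c Q"
    "hoare w b (\<lambda>s. P s \<and> \<not> outcome w i s) d Q"
  shows "hoare w b P (Cond i c d) Q"
  unfolding hoare_def
proof (intro allI impI)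
  fix s assume "P s"
  then obtain s' where "exec w b (if outcome w i s then c else d) s s'" "Q s'"
    using assms(2,3) unfolding hoare_def by (cases "outcome w i s") auto
  then show "\<exists>s'. exec w b (Cond i c d) s s' \<and> Q s'"
    using is_test[OF assms(1), of b s w] by (intro exI[of _ s'] conjI exec_Cond) auto
qed

text \<open>Every loop used below runs a number of times known beforehand, so an invariant indexed
  by the iteration takes the place of a termination measure.\<close>

lemma hoare_While:
  assumes "is_test g" "\<And>i s. i < N \<Longrightarrow> I i s \<Longrightarrow> outcome w g s" "\<And>s. I N s \<Longrightarrow> \<not> outcome w g s"
    and body: "\<And>i. i < N \<Longrightarrow> hoare w b (I i) c (I (Suc i))"
  shows "hoare w b (I 0) (While g c) (I N)"
proof -
  have "hoare w b (I i) (While g c) (I N)" if "i \<le> N" for i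
    using that
  proof (induction i rule: inc_induct)
    case base
    show ?case
      unfolding hoare_def
    proof (intro allI impI)
      fix s assume "I N s"
      then show "\<exists>s'. exec w b (While g c) s s' \<and> I N s'"
        using assms(3)[of s] is_test[OF assms(1), of b s w] exec_Skip
        by (intro exI[of _ s] conjI exec_While) auto
    qed
  next
    case (step i)
    show ?case
      unfolding hoare_def
    proof (intro allI impI)
      fix s assume s: "I i s"
      obtain s1 where s1: "exec w b c s s1" "I (Suc i) s1"
        using body[OF step.hyps(2)] s unfolding hoare_def by blast
      obtain s2 where s2: "exec w b (While g c) s1 s2" "I N s2"
        using step.IH s1(2) unfolding hoare_def by blast
      have "exec w b (c ;; While g c) s s2" using s1(1) s2(1) by (rule exec_Seq)
      then show "\<exists>s'. exec w b (While g c) s s' \<and> I N s'"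
        using s2(2) assms(2)[OF step.hyps(2) s] is_test[OF assms(1), of b s w]
        by (intro exI[of _ s2] conjI exec_While) auto
    qed
  qed
  then show ?thesis by blast
qed

definition block :: "('r, 'a, 'b) com list \<Rightarrow> ('r, 'a, 'b) com" where
  "block cs = foldr Seq cs Skip"

lemma com_in_block: "com_in R B (block cs) \<longleftrightarrow> (\<forall>c\<in>set cs. com_in R B c)"
  by (induction cs) (auto simp: block_def)

lemma hoare_block:
  assumes "\<And>i. i < length cs \<Longrightarrow> hoare w b (I i) (cs ! i) (I (Suc i))"
  shows "hoare w b (I 0) (block cs) (I (length cs))"
  using assms
proof (induction cs arbitrary: I)
  case Nil
  then show ?case by (simp add: block_def hoare_Skip)
next
  case (Cons c cs)
  have "hoare w b (I 0) c (I (Suc 0))" using Cons.prems[of 0] by simp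
  moreover have "hoare w b (I (Suc 0)) (block cs) (I (Suc (length cs)))"
    using Cons.IH[of "\<lambda>i. I (Suc i)"] Cons.prems by force
  ultimately show ?case unfolding block_def by (simp add: hoare_Seq)
qed


section \<open>Counter programs for modular linear arithmetic\<close>

text \<open>Registers can only be compared with one another, so \<open>Null\<close> is kept at 0 as
  a constant. \<open>Limit\<close> holds the last modulus to be tried.\<close>

datatype 'v ctr = Null | Limit | Modulus | Flag | Aux | Var 'v

text \<open>Integer affine maps as straight-line code. Each operation can be done modulo m by
  counting, and each at most doubles a bound of at least 1 on the absolute values.\<close>

datatype 'v lin = Add 'v 'v | Neg 'v | One 'v

fun lin_step :: "'v lin \<Rightarrow> ('v \<Rightarrow> int) \<Rightarrow> 'v \<Rightarrow> int" where
  "lin_step (Add u v) x = x(u := x u + x v)"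
| "lin_step (Neg u) x = x(u := - x u)"
| "lin_step (One u) x = x(u := x u + 1)"

abbreviation lin_run :: "'v lin list \<Rightarrow> ('v \<Rightarrow> int) \<Rightarrow> 'v \<Rightarrow> int" where
  "lin_run ops \<equiv> fold lin_step ops"

text \<open>The operands of \<open>Add\<close> must differ because its code counts up to register
  \<open>v\<close> while changing register \<open>u\<close>.\<close>

fun lin_in :: "'v set \<Rightarrow> 'v lin \<Rightarrow> bool" where
  "lin_in V (Add u v) \<longleftrightarrow> u \<in> V \<and> v \<in> V \<and> u \<noteq> v"
| "lin_in V (Neg u) \<longleftrightarrow> u \<in> V"
| "lin_in V (One u) \<longleftrightarrow> u \<in> V"

lemma lin_run_bound:
  assumes "\<And>v. \<bar>x v\<bar> \<le> B" "1 \<le> B"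
  shows "\<bar>lin_run ops x v\<bar> \<le> 2 ^ length ops * B"
  using assms
proof (induction ops arbitrary: x B)
  case (Cons e ops)
  have 1: "\<bar>lin_step e x v\<bar> \<le> 2 * B" for v
  proof (cases e)
    case (Add u u')
    then show ?thesis using Cons.prems(1)[of u] Cons.prems(1)[of u'] Cons.prems(1)[of v] by auto
  next
    case (Neg u)
    then show ?thesis using Cons.prems(1)[of u] Cons.prems(1)[of v] by auto
  next
    case (One u)
    then show ?thesis using Cons.prems(1)[of u] Cons.prems(1)[of v] Cons.prems(2) by auto
  qed
  have "\<bar>lin_run ops (lin_step e x) v\<bar> \<le> 2 ^ length ops * (2 * B)"
    by (rule Cons.IH) (use 1 Cons.prems(2) in auto)
  then show ?case by simp
qed simp

definition mod_inc :: "'v ctr \<Rightarrow> ('v ctr, 'a, 'b) com" where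
  "mod_inc r = Prim (Inc r) ;; Cond (Neq r Modulus) Skip (Prim (Zero r))"

text \<open>For \<open>Neg\<close>, \<open>Aux\<close> first climbs to the residue x of
  \<open>u\<close> and then on to the modulus m, while \<open>u\<close> counts the m - x remaining
  steps; for x = 0 the last of them wraps round to 0.\<close>

fun lin_code :: "'v lin \<Rightarrow> ('v ctr, 'a, 'b) com" where
  "lin_code (Add u v) =
    Prim (Zero Aux) ;; While (Neq Aux (Var v)) (Prim (Inc Aux) ;; mod_inc (Var u))"
| "lin_code (Neg u) =
    Prim (Zero Aux) ;; While (Neq Aux (Var u)) (Prim (Inc Aux)) ;; Prim (Zero (Var u)) ;;
    While (Neq Aux Modulus) (Prim (Inc Aux) ;; mod_inc (Var u))"
| "lin_code (One u) = mod_inc (Var u)"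

definition lin_codes :: "'v lin list \<Rightarrow> ('v ctr, 'a, 'b) com" where
  "lin_codes ops = block (map lin_code ops)"

definition ctrl :: "nat \<Rightarrow> nat \<Rightarrow> nat \<Rightarrow> nat \<Rightarrow> 'b list \<Rightarrow> ('v ctr, 'b) store \<Rightarrow> bool" where
  "ctrl K m f p ow s \<longleftrightarrow> reg s Null = 0 \<and> reg s Limit = K \<and> reg s Modulus = m \<and> reg s Flag = f \<and>
    pos s = p \<and> out s = ow"

definition residues :: "'v set \<Rightarrow> nat \<Rightarrow> ('v \<Rightarrow> int) \<Rightarrow> ('v ctr, 'b) store \<Rightarrow> bool" where
  "residues V m x s \<longleftrightarrow> (\<forall>v\<in>V. int (reg s (Var v)) = x v mod int m)"

lemma residues_cong:
  "residues V m x s \<Longrightarrow> (\<And>v. v \<in> V \<Longrightarrow> x v mod int m = y v mod int m) \<Longrightarrow> residues V m y s"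
  by (simp add: residues_def)

lemma hoare_mod_inc:
  assumes "\<And>s. P s \<Longrightarrow> reg s (Var u) < reg s Modulus \<and> reg s Modulus \<le> b \<and>
    Q (s\<lparr>reg := (reg s)(Var u := Suc (reg s (Var u)) mod reg s Modulus)\<rparr>)"
  shows "hoare w b P (mod_inc (Var u)) Q"
  unfolding mod_inc_def
proof (rule hoare_Seq)
  let ?R = "\<lambda>s'. \<exists>s. P s \<and> s' = s\<lparr>reg := (reg s)(Var u := Suc (reg s (Var u)))\<rparr>"
  show "hoare w b P (Prim (Inc (Var u))) ?R"
    using assms by (intro hoare_Prim) fastforce+
  show "hoare w b ?R (Cond (Neq (Var u) Modulus) Skip (Prim (Zero (Var u)))) Q"
  proof (rule hoare_Cond)
    show "hoare w b (\<lambda>s. ?R s \<and> outcome w (Neq (Var u) Modulus) s) Skip Q"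
    proof (rule hoare_Skip)
      fix s' assume "?R s' \<and> outcome w (Neq (Var u) Modulus) s'"
      then obtain s where s: "P s" "s' = s\<lparr>reg := (reg s)(Var u := Suc (reg s (Var u)))\<rparr>"
          "Suc (reg s (Var u)) \<noteq> reg s Modulus" by auto
      then have "Suc (reg s (Var u)) mod reg s Modulus = Suc (reg s (Var u))"
        using assms[OF s(1)] by auto
      then show "Q s'" using assms[OF s(1)] s(2) by simp
    qed
    show "hoare w b (\<lambda>s. ?R s \<and> \<not> outcome w (Neq (Var u) Modulus) s) (Prim (Zero (Var u))) Q"
    proof (rule hoare_Prim)
      fix s' assume "?R s' \<and> \<not> outcome w (Neq (Var u) Modulus) s'"
      then obtain s where s: "P s" "s' = s\<lparr>reg := (reg s)(Var u := Suc (reg s (Var u)))\<rparr>"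
          "Suc (reg s (Var u)) = reg s Modulus" by auto
      then have "Suc (reg s (Var u)) mod reg s Modulus = 0" by simp
      then show "Q (effect w (Zero (Var u)) s')" using assms[OF s(1)] s(2) by simp
    qed simp
  qed simp
qed

context
  fixes w :: "'a list" and b :: nat and V :: "'v set" and m :: nat
  assumes m: "0 < m" "m \<le> b"
begin

lemma hoare_mod_inc_residues:
  assumes "u \<in> V"
  shows "hoare w b (\<lambda>s. ctrl K m f p ow s \<and> residues V m x s \<and> reg s Aux = k) (mod_inc (Var u))
    (\<lambda>s. ctrl K m f p ow s \<and> residues V m (x(u := x u + 1)) s \<and> reg s Aux = k)"
proof (rule hoare_mod_inc)
  fix s :: "('v ctr, 'b) store"
  assume s: "ctrl K m f p ow s \<and> residues V m x s \<and> reg s Aux = k"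
  then have u: "int (reg s (Var u)) = x u mod int m" using assms by (simp add: residues_def)
  then have "int (reg s (Var u)) < int m" using m by simp
  moreover have "int (Suc (reg s (Var u)) mod m) = (x u + 1) mod int m"
    using u by (simp add: of_nat_mod mod_simps add.commute)
  ultimately show "reg s (Var u) < reg s Modulus \<and> reg s Modulus \<le> b \<and>
      ctrl K m f p ow (s\<lparr>reg := (reg s)(Var u := Suc (reg s (Var u)) mod reg s Modulus)\<rparr>) \<and>
      residues V m (x(u := x u + 1))
        (s\<lparr>reg := (reg s)(Var u := Suc (reg s (Var u)) mod reg s Modulus)\<rparr>) \<and>
      reg (s\<lparr>reg := (reg s)(Var u := Suc (reg s (Var u)) mod reg s Modulus)\<rparr>) Aux = k"
    using s m by (auto simp: ctrl_def residues_def)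
qed

lemma hoare_aux_step:
  assumes "u \<in> V" "k < b"
  shows "hoare w b (\<lambda>s. ctrl K m f p ow s \<and> residues V m (x(u := y)) s \<and> reg s Aux = k)
    (Prim (Inc Aux) ;; mod_inc (Var u))
    (\<lambda>s. ctrl K m f p ow s \<and> residues V m (x(u := y + 1)) s \<and> reg s Aux = Suc k)"
proof (rule hoare_Seq)
  show "hoare w b (\<lambda>s. ctrl K m f p ow s \<and> residues V m (x(u := y)) s \<and> reg s Aux = k)
    (Prim (Inc Aux)) (\<lambda>s. ctrl K m f p ow s \<and> residues V m (x(u := y)) s \<and> reg s Aux = Suc k)"
    using assms by (intro hoare_Prim) (auto simp: ctrl_def residues_def)
  show "hoare w b (\<lambda>s. ctrl K m f p ow s \<and> residues V m (x(u := y)) s \<and> reg s Aux = Suc k)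
    (mod_inc (Var u))
    (\<lambda>s. ctrl K m f p ow s \<and> residues V m (x(u := y + 1)) s \<and> reg s Aux = Suc k)"
    using hoare_mod_inc_residues[OF assms(1), of K f p ow "x(u := y)" "Suc k"] by simp
qed

lemma hoare_Add:
  assumes "lin_in V (Add u v)"
  shows "hoare w b (\<lambda>s. ctrl K m f p ow s \<and> residues V m x s) (lin_code (Add u v))
    (\<lambda>s. ctrl K m f p ow s \<and> residues V m (lin_step (Add u v) x) s)"
proof -
  define N where "N = nat (x v mod int m)"
  have N: "int N = x v mod int m" "N < b" using m by (auto simp: N_def nat_less_iff
      intro: less_le_trans[OF pos_mod_bound])
  let ?I = "\<lambda>i s. ctrl K m f p ow s \<and> residues V m (x(u := x u + int i)) s \<and> reg s Aux = i"
  have v: "reg s (Var v) = N" if "?I i s" for i s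
    using that assms N(1) by (auto simp: residues_def)
  have "hoare w b (\<lambda>s. ctrl K m f p ow s \<and> residues V m x s) (Prim (Zero Aux)) (?I 0)"
    by (intro hoare_Prim) (auto simp: ctrl_def residues_def)
  moreover have "hoare w b (?I 0)
      (While (Neq Aux (Var v)) (Prim (Inc Aux) ;; mod_inc (Var u))) (?I N)"
  proof (rule hoare_While)
    fix i assume i: "i < N"
    show "hoare w b (?I i) (Prim (Inc Aux) ;; mod_inc (Var u)) (?I (Suc i))"
      using hoare_aux_step[of u i K f p ow x "x u + int i"] assms N(2) i by (simp add: ac_simps)
  next
    fix i s assume "i < N" and I: "?I i s"
    then show "outcome w (Neq Aux (Var v)) s" using v[OF I] by simp
  next
    fix s assume I: "?I N s"
    then show "\<not> outcome w (Neq Aux (Var v)) s" using v[OF I] by simp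
  qed simp
  moreover have "residues V m (lin_step (Add u v) x) s" if "?I N s" for s
    by (rule residues_cong[of V m "x(u := x u + int N)"])
      (use that N(1) in \<open>auto simp: mod_simps\<close>)
  ultimately show ?thesis
    unfolding lin_code.simps by (intro hoare_Seq[of w b]) (auto elim: hoare_conseq)
qed

lemma hoare_Neg:
  assumes "lin_in V (Neg u)"
  shows "hoare w b (\<lambda>s. ctrl K m f p ow s \<and> residues V m x s) (lin_code (Neg u))
    (\<lambda>s. ctrl K m f p ow s \<and> residues V m (lin_step (Neg u) x) s)"
proof -
  define N where "N = nat (x u mod int m)"
  have N: "int N = x u mod int m" "N < m" using m by (auto simp: N_def nat_less_iff)
  let ?J = "\<lambda>i s. ctrl K m f p ow s \<and> residues V m x s \<and> reg s Aux = i"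
  let ?I = "\<lambda>i s. ctrl K m f p ow s \<and> residues V m (x(u := int i)) s \<and> reg s Aux = N + i"
  have u: "reg s (Var u) = N" if "?J i s" for i s
    using that assms N(1) by (auto simp: residues_def)
  have "hoare w b (\<lambda>s. ctrl K m f p ow s \<and> residues V m x s) (Prim (Zero Aux)) (?J 0)"
    by (intro hoare_Prim) (auto simp: ctrl_def residues_def)
  moreover have "hoare w b (?J 0) (While (Neq Aux (Var u)) (Prim (Inc Aux))) (?J N)"
  proof (rule hoare_While)
    fix i assume i: "i < N"
    show "hoare w b (?J i) (Prim (Inc Aux)) (?J (Suc i))"
      using i N(2) m(2) by (intro hoare_Prim) (auto simp: ctrl_def residues_def)
  next
    fix i s assume "i < N" and J: "?J i s"
    then show "outcome w (Neq Aux (Var u)) s" using u[OF J] by simp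
  next
    fix s assume J: "?J N s"
    then show "\<not> outcome w (Neq Aux (Var u)) s" using u[OF J] by simp
  qed simp
  moreover have "hoare w b (?J N) (Prim (Zero (Var u))) (?I 0)"
    by (intro hoare_Prim) (auto simp: ctrl_def residues_def)
  moreover have "hoare w b (?I 0)
      (While (Neq Aux Modulus) (Prim (Inc Aux) ;; mod_inc (Var u))) (?I (m - N))"
  proof (rule hoare_While)
    fix i assume i: "i < m - N"
    show "hoare w b (?I i) (Prim (Inc Aux) ;; mod_inc (Var u)) (?I (Suc i))"
      using hoare_aux_step[of u "N + i" K f p ow x "int i"] assms m(2) i by (simp add: ac_simps)
  qed (use N(2) in \<open>auto simp: ctrl_def\<close>)
  moreover have "residues V m (lin_step (Neg u) x) s" if "?I (m - N) s" for s
  proof (rule residues_cong[of V m "x(u := int (m - N))"])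
    have "int (m - N) mod int m = (int m - x u mod int m) mod int m"
      using N by (simp add: of_nat_diff)
    also have "\<dots> = (- x u) mod int m" by (simp add: mod_simps)
    finally show "(x(u := int (m - N))) v mod int m = lin_step (Neg u) x v mod int m" for v
      by simp
  qed (use that in blast)
  ultimately show ?thesis
    unfolding lin_code.simps by (intro hoare_Seq[of w b]) (auto elim: hoare_conseq)
qed

lemma hoare_lin_code:
  assumes "lin_in V e"
  shows "hoare w b (\<lambda>s. ctrl K m f p ow s \<and> residues V m x s) (lin_code e)
    (\<lambda>s. ctrl K m f p ow s \<and> residues V m (lin_step e x) s)"
proof (cases e)
  case (One u)
  have "hoare w b (\<lambda>s. (ctrl K m f p ow s \<and> residues V m x s) \<and> reg s Aux = k) (mod_inc (Var u))
      (\<lambda>s. ctrl K m f p ow s \<and> residues V m (lin_step e x) s)" for k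
    using hoare_mod_inc_residues[of u K f p ow x k] assms One
    by (auto elim: hoare_conseq)
  then show ?thesis unfolding One lin_code.simps hoare_def by blast
qed (use assms hoare_Add hoare_Neg in \<open>simp_all only:\<close>)

lemma hoare_lin_codes:
  assumes "\<And>e. e \<in> set ops \<Longrightarrow> lin_in V e"
  shows "hoare w b (\<lambda>s. ctrl K m f p ow s \<and> residues V m x s) (lin_codes ops)
    (\<lambda>s. ctrl K m f p ow s \<and> residues V m (lin_run ops x) s)"
  using assms
proof (induction ops arbitrary: x)
  case Nil
  show ?case by (simp add: lin_codes_def block_def hoare_Skip)
next
  case (Cons e ops)
  then show ?case
    using hoare_Seq[OF hoare_lin_code[of e K f p ow x] Cons.IH[of "lin_step e x"]]
    by (simp add: lin_codes_def block_def)
qed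

end


section \<open>Passes over the input and the zero test by moduli\<close>

definition rewind :: "('r, 'a, 'b) com" where
  "rewind = While (Sym (\<lambda>x. x \<noteq> Left_End)) (Prim (Go Move_Left))"

definition scan :: "('r, 'a, 'b) com \<Rightarrow> ('r, 'a, 'b) com" where
  "scan c = Prim (Go Move_Right) ;;
    While (Sym (\<lambda>x. x \<noteq> Right_End)) (c ;; Prim (Go Move_Right))"

fun dispatch :: "('a \<Rightarrow> ('r, 'a, 'b) com) \<Rightarrow> 'a list \<Rightarrow> ('r, 'a, 'b) com" where
  "dispatch f [] = Skip"
| "dispatch f (a # as) = Cond (Sym (\<lambda>x. x = Letter a)) (f a) (dispatch f as)"

lemma hoare_dispatch:
  assumes "a \<in> set as" "hoare w b P (f a) Q"
    "\<And>s. P s \<Longrightarrow> input_symbol_at w (pos s) = Letter a"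
  shows "hoare w b P (dispatch f as) Q"
  using assms(1)
proof (induction as)
  case (Cons c as)
  show ?case
    unfolding dispatch.simps
  proof (rule hoare_Cond)
    show "hoare w b (\<lambda>s. P s \<and> outcome w (Sym (\<lambda>x. x = Letter c)) s) (f c) Q"
    proof (cases "c = a")
      case True
      then show ?thesis using assms(2) unfolding hoare_def by blast
    next
      case False
      then show ?thesis using assms(3) by (auto simp: hoare_def)
    qed
    show "hoare w b (\<lambda>s. P s \<and> \<not> outcome w (Sym (\<lambda>x. x = Letter c)) s) (dispatch f as) Q"
    proof (cases "c = a")
      case True
      then show ?thesis using assms(3) by (auto simp: hoare_def)
    next
      case False
      then show ?thesis using Cons unfolding hoare_def by simp
    qed
  qed simp
qed simp

lemma input_symbol_at_Suc: "i < length w \<Longrightarrow> input_symbol_at w (Suc i) = Letter (w ! i)"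
  by (simp add: input_symbol_at_def)

lemma hoare_rewind:
  assumes "p \<le> length w + 1"
  shows "hoare w b (ctrl K m f p ow) rewind (ctrl K m f 0 ow)"
proof -
  let ?I = "\<lambda>i. ctrl K m f (p - i) ow"
  have "hoare w b (?I 0) rewind (?I p)"
    unfolding rewind_def
  proof (rule hoare_While)
    fix i assume "i < p"
    then show "hoare w b (?I i) (Prim (Go Move_Left)) (?I (Suc i))"
      using assms by (intro hoare_Prim) (auto simp: ctrl_def)
  qed (auto simp: ctrl_def input_symbol_at_def)
  then show ?thesis by simp
qed

lemma hoare_scan:
  assumes go: "\<And>i p s. I i s \<Longrightarrow> I i (s\<lparr>pos := p\<rparr>)"
    and c: "\<And>i. i < length w \<Longrightarrow>
      hoare w b (\<lambda>s. I i s \<and> pos s = Suc i) c (\<lambda>s. I (Suc i) s \<and> pos s = Suc i)"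
  shows "hoare w b (\<lambda>s. I 0 s \<and> pos s = 0) (scan c)
    (\<lambda>s. I (length w) s \<and> pos s = length w + 1)"
proof -
  let ?I = "\<lambda>i s. I i s \<and> pos s = Suc i"
  have "hoare w b (\<lambda>s. I 0 s \<and> pos s = 0) (Prim (Go Move_Right)) (?I 0)"
    by (intro hoare_Prim) (auto intro: go)
  moreover have "hoare w b (?I 0)
      (While (Sym (\<lambda>x. x \<noteq> Right_End)) (c ;; Prim (Go Move_Right))) (?I (length w))"
  proof (rule hoare_While)
    fix i assume i: "i < length w"
    have "hoare w b (\<lambda>s. I (Suc i) s \<and> pos s = Suc i) (Prim (Go Move_Right)) (?I (Suc i))"
      using i by (intro hoare_Prim) (auto intro: go)
    with c[OF i] show "hoare w b (?I i) (c ;; Prim (Go Move_Right)) (?I (Suc i))"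
      by (rule hoare_Seq)
  qed (auto simp: input_symbol_at_def)
  ultimately show ?thesis unfolding scan_def by (simp add: hoare_Seq)
qed

definition clear :: "'v list \<Rightarrow> ('v ctr, 'a, 'b) com" where
  "clear vs = block (map (\<lambda>v. Prim (Zero (Var v))) vs)"

lemma hoare_clear:
  "hoare w b (ctrl K m f p ow) (clear vs) (\<lambda>s. ctrl K m f p ow s \<and> residues (set vs) m (\<lambda>_. 0) s)"
proof -
  let ?I = "\<lambda>i s. ctrl K m f p ow s \<and> residues (set (take i vs)) m (\<lambda>_. 0) s"
  have "hoare w b (?I i) (map (\<lambda>v. Prim (Zero (Var v))) vs ! i) (?I (Suc i))" if "i < length vs" for i
    using that
    by (auto intro!: hoare_Prim simp: ctrl_def residues_def take_Suc_conv_app_nth)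
  then show ?thesis
    using hoare_block[of "map (\<lambda>v. Prim (Zero (Var v))) vs" w b ?I]
    by (simp add: clear_def residues_def)
qed

text \<open>An iterated matrix product: \<open>fst t\<close> builds the start vector, the letters
  act on it in turn, and \<open>snd t\<close> evaluates the condition under test.\<close>

definition lin_value :: "('a \<Rightarrow> 'v lin list) \<Rightarrow> 'a list \<Rightarrow> 'v lin list \<times> 'v lin list \<Rightarrow> 'v \<Rightarrow> int" where
  "lin_value P w t = lin_run (snd t) (fold (\<lambda>a. lin_run (P a)) w (lin_run (fst t) (\<lambda>_. 0)))"

text \<open>The values are recomputed from the input for each modulus. Clearing \<open>Flag\<close>
  before the increment keeps it at 1 however many moduli fail.\<close>

definition trial :: "'v list \<Rightarrow> 'a list \<Rightarrow> ('a \<Rightarrow> 'v lin list) \<Rightarrow> 'v \<Rightarrow> 'v lin list \<times> 'v lin list \<Rightarrow>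
    ('v ctr, 'a, 'b) com" where
  "trial vs as P z t = rewind ;; clear vs ;; lin_codes (fst t) ;;
    scan (dispatch (\<lambda>a. lin_codes (P a)) as) ;; lin_codes (snd t) ;;
    Cond (Neq (Var z) Null) (Prim (Zero Flag) ;; Prim (Inc Flag)) Skip"

definition zero_test :: "'v list \<Rightarrow> 'a list \<Rightarrow> ('a \<Rightarrow> 'v lin list) \<Rightarrow> 'v \<Rightarrow>
    'v lin list \<times> 'v lin list \<Rightarrow> ('v ctr, 'a, 'b) com" where
  "zero_test vs as P z t =
    Prim (Zero Modulus) ;; While (Neq Modulus Limit) (Prim (Inc Modulus) ;; trial vs as P z t)"

context
  fixes vs :: "'v list" and as :: "'a list" and P :: "'a \<Rightarrow> 'v lin list" and z :: 'v
    and w :: "'a list" and q b :: nat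
  assumes P: "\<And>a e. a \<in> set as \<Longrightarrow> e \<in> set (P a) \<Longrightarrow> lin_in (set vs) e"
    and len_P: "\<And>a. a \<in> set as \<Longrightarrow> length (P a) \<le> q"
    and z: "z \<in> set vs"
    and w: "w \<in> lists (set as)"
begin

lemma hoare_trial:
  assumes t: "\<And>e. e \<in> set (fst t) \<Longrightarrow> lin_in (set vs) e" "\<And>e. e \<in> set (snd t) \<Longrightarrow> lin_in (set vs) e"
    and m: "0 < m" "m \<le> b" and p: "p \<le> length w + 1"
  shows "hoare w b (ctrl K m f p ow) (trial vs as P z t)
    (ctrl K m (if int m dvd lin_value P w t z then f else 1) (length w + 1) ow)"
proof -
  let ?V = "set vs"
  let ?start = "lin_run (fst t) (\<lambda>_. 0)"
  let ?x = "\<lambda>i. fold (\<lambda>a. lin_run (P a)) (take i w) ?start"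
  let ?N = "length w"
  let ?y = "lin_value P w t"
  \<comment> \<open>The existential position makes the invariant insensitive to head moves, as
    \<open>hoare_scan\<close> requires; the actual position is tracked by the other
    conjunct.\<close>
  have "hoare w b (\<lambda>s. (\<exists>p'. ctrl K m f p' ow s \<and> residues ?V m (?x 0) s) \<and> pos s = 0)
      (scan (dispatch (\<lambda>a. lin_codes (P a)) as))
      (\<lambda>s. (\<exists>p'. ctrl K m f p' ow s \<and> residues ?V m (?x ?N) s) \<and> pos s = ?N + 1)"
  proof (rule hoare_scan)
    fix i assume i: "i < length w"
    then have a: "w ! i \<in> set as" using w by (auto simp: in_lists_conv_set)
    have "?x (Suc i) = lin_run (P (w ! i)) (?x i)"
      using i by (simp add: take_Suc_conv_app_nth)
    then have "hoare w b (\<lambda>s. ctrl K m f (Suc i) ow s \<and> residues ?V m (?x i) s)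
        (lin_codes (P (w ! i))) (\<lambda>s. ctrl K m f (Suc i) ow s \<and> residues ?V m (?x (Suc i)) s)"
      using hoare_lin_codes[OF m, of "P (w ! i)" ?V] P[OF a] by simp
    then have "hoare w b (\<lambda>s. ctrl K m f (Suc i) ow s \<and> residues ?V m (?x i) s)
        (dispatch (\<lambda>a. lin_codes (P a)) as)
        (\<lambda>s. ctrl K m f (Suc i) ow s \<and> residues ?V m (?x (Suc i)) s)"
      by (rule hoare_dispatch[OF a]) (use i in \<open>auto simp: ctrl_def input_symbol_at_Suc\<close>)
    then show "hoare w b (\<lambda>s. (\<exists>p'. ctrl K m f p' ow s \<and> residues ?V m (?x i) s) \<and> pos s = Suc i)
        (dispatch (\<lambda>a. lin_codes (P a)) as)
        (\<lambda>s. (\<exists>p'. ctrl K m f p' ow s \<and> residues ?V m (?x (Suc i)) s) \<and> pos s = Suc i)"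
      by (rule hoare_conseq) (auto simp: ctrl_def)
  qed (auto simp: ctrl_def residues_def)
  then have scan: "hoare w b (\<lambda>s. ctrl K m f 0 ow s \<and> residues ?V m ?start s)
      (scan (dispatch (\<lambda>a. lin_codes (P a)) as))
      (\<lambda>s. ctrl K m f (?N + 1) ow s \<and> residues ?V m (?x ?N) s)"
    by (rule hoare_conseq) (auto simp: ctrl_def)
  have fin: "hoare w b (\<lambda>s. ctrl K m f (?N + 1) ow s \<and> residues ?V m (?x ?N) s)
      (lin_codes (snd t)) (\<lambda>s. ctrl K m f (?N + 1) ow s \<and> residues ?V m ?y s)"
    using hoare_lin_codes[OF m, of "snd t" ?V] t(2) by (simp add: lin_value_def)
  let ?Q = "ctrl K m (if int m dvd ?y z then f else 1) (?N + 1) ow"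
  have test: "hoare w b (\<lambda>s. ctrl K m f (?N + 1) ow s \<and> residues ?V m ?y s)
      (Cond (Neq (Var z) Null) (Prim (Zero Flag) ;; Prim (Inc Flag)) Skip) ?Q"
  proof (rule hoare_Cond)
    have dvd: "reg s (Var z) = 0 \<longleftrightarrow> int m dvd ?y z" if "residues ?V m ?y s" for s :: "('v ctr, 'b) store"
      using that z by (auto simp: residues_def dvd_eq_mod_eq_0)
    let ?R = "\<lambda>s. ctrl K m 0 (?N + 1) ow s \<and> \<not> int m dvd ?y z"
    have "hoare w b (\<lambda>s. (ctrl K m f (?N + 1) ow s \<and> residues ?V m ?y s) \<and>
        outcome w (Neq (Var z) Null) s) (Prim (Zero Flag)) ?R"
      by (rule hoare_Prim) (auto simp: ctrl_def dvd)
    moreover have "hoare w b ?R (Prim (Inc Flag)) ?Q"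
      using m by (intro hoare_Prim) (auto simp: ctrl_def)
    ultimately show "hoare w b (\<lambda>s. (ctrl K m f (?N + 1) ow s \<and> residues ?V m ?y s) \<and>
        outcome w (Neq (Var z) Null) s) (Prim (Zero Flag) ;; Prim (Inc Flag)) ?Q"
      by (rule hoare_Seq)
    show "hoare w b (\<lambda>s. (ctrl K m f (?N + 1) ow s \<and> residues ?V m ?y s) \<and>
        \<not> outcome w (Neq (Var z) Null) s) Skip ?Q"
      by (rule hoare_Skip) (auto simp: ctrl_def dvd)
  qed simp
  have init: "hoare w b (\<lambda>s. ctrl K m f 0 ow s \<and> residues ?V m (\<lambda>_. 0) s) (lin_codes (fst t))
      (\<lambda>s. ctrl K m f 0 ow s \<and> residues ?V m ?start s)"
    by (rule hoare_lin_codes[OF m t(1)])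
  show ?thesis
    unfolding trial_def
    by (rule hoare_Seq[OF hoare_rewind[OF p] hoare_Seq[OF hoare_clear hoare_Seq[OF init
      hoare_Seq[OF scan hoare_Seq[OF fin test]]]]])
qed

text \<open>There are \<open>length w + 2\<close> blocks of code, one per letter and one at either
  end, and each multiplies the bound by at most 2 ^ q.\<close>

lemma lin_value_bound:
  assumes "length (fst t) \<le> q" "length (snd t) \<le> q"
  shows "\<bar>lin_value P w t v\<bar> \<le> 2 ^ (q * (length w + 2))"
proof -
  have pow: "(2 :: int) ^ length ops \<le> 2 ^ q" if "length ops \<le> q" for ops :: "'v lin list"
    using that by (intro power_increasing) auto
  have step: "\<bar>lin_run ops x v\<bar> \<le> 2 ^ q * B"
    if "length ops \<le> q" "\<And>v. \<bar>x v\<bar> \<le> B" "1 \<le> B" for ops :: "'v lin list" and x B v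
    using lin_run_bound[of x B ops v, OF that(2,3)] mult_right_mono[OF pow[OF that(1)], of B] that(3)
    by linarith
  have fold: "\<bar>fold (\<lambda>a. lin_run (P a)) u x v\<bar> \<le> (2 ^ q) ^ length u * B"
    if "u \<in> lists (set as)" "\<And>v. \<bar>x v\<bar> \<le> B" "1 \<le> B" for u x B v
    using that
  proof (induction u arbitrary: x B rule: list.induct)
    case (Cons a u)
    have a: "a \<in> set as" and u: "u \<in> lists (set as)" using Cons.prems(1) by auto
    have "(1 :: int) \<le> 2 ^ q" by simp
    then have "1 * 1 \<le> 2 ^ q * B" using Cons.prems(3) by (intro mult_mono) auto
    then have "\<bar>fold (\<lambda>a. lin_run (P a)) u (lin_run (P a) x) v\<bar> \<le> (2 ^ q) ^ length u * (2 ^ q * B)"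
      using step[OF len_P[OF a]] Cons.prems(2,3) by (intro Cons.IH[OF u]) auto
    then show ?case by (simp add: ac_simps)
  qed simp
  have "\<bar>lin_run (fst t) (\<lambda>_. 0) v\<bar> \<le> 2 ^ q" for v
    using step[OF assms(1), of "\<lambda>_. 0" 1] by simp
  then have "\<bar>fold (\<lambda>a. lin_run (P a)) w (lin_run (fst t) (\<lambda>_. 0)) v\<bar> \<le> (2 ^ q) ^ length w * 2 ^ q" for v
    using fold[OF w] by simp
  then have "\<bar>lin_value P w t v\<bar> \<le> 2 ^ q * ((2 ^ q) ^ length w * 2 ^ q)"
    unfolding lin_value_def by (intro step[OF assms(2)]) (auto simp flip: power_mult power_add)
  then show ?thesis by (simp flip: power_mult power_add add: algebra_simps)
qed

lemma hoare_zero_test: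
  assumes t: "\<And>e. e \<in> set (fst t) \<Longrightarrow> lin_in (set vs) e" "\<And>e. e \<in> set (snd t) \<Longrightarrow> lin_in (set vs) e"
      "length (fst t) \<le> q" "length (snd t) \<le> q"
    and K: "K \<le> b" "(2 * q + 3) * (length w + 1) \<le> K"
  shows "hoare w b (\<lambda>s. \<exists>m p. ctrl K m (of_bool d) p ow s \<and> p \<le> length w + 1) (zero_test vs as P z t)
    (\<lambda>s. \<exists>m p. ctrl K m (of_bool (d \<or> lin_value P w t z \<noteq> 0)) p ow s \<and> p \<le> length w + 1)"
proof -
  let ?y = "lin_value P w t z"
  let ?f = "\<lambda>i. of_bool (d \<or> (\<exists>m\<in>{1..i}. \<not> int m dvd ?y)) :: nat"
  let ?I = "\<lambda>i s. \<exists>p. ctrl K i (?f i) p ow s \<and> p \<le> length w + 1"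
  have 1: "hoare w b (\<lambda>s. \<exists>m p. ctrl K m (of_bool d) p ow s \<and> p \<le> length w + 1)
      (Prim (Zero Modulus)) (?I 0)"
    by (rule hoare_Prim) (auto simp: ctrl_def)
  have 2: "hoare w b (?I 0) (While (Neq Modulus Limit) (Prim (Inc Modulus) ;; trial vs as P z t)) (?I K)"
  proof (rule hoare_While)
    fix i assume i: "i < K"
    have f: "?f (Suc i) = (if int (Suc i) dvd ?y then ?f i else 1)"
      by (auto simp: atLeastAtMostSuc_conv)
    have "hoare w b (?I i) (Prim (Inc Modulus)) (\<lambda>s. \<exists>p. ctrl K (Suc i) (?f i) p ow s \<and> p \<le> length w + 1)"
      using i K(1) by (intro hoare_Prim) (auto simp: ctrl_def)
    moreover have "hoare w b (\<lambda>s. \<exists>p. ctrl K (Suc i) (?f i) p ow s \<and> p \<le> length w + 1)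
        (trial vs as P z t) (?I (Suc i))"
      using hoare_trial[where t = t and m = "Suc i" and K = K and f = "?f i" and ow = ow, OF t(1,2)]
        i K(1)
      unfolding hoare_def f by fastforce
    ultimately show "hoare w b (?I i) (Prim (Inc Modulus) ;; trial vs as P z t) (?I (Suc i))"
      by (rule hoare_Seq)
  qed (auto simp: ctrl_def)
  have "?y = 0" if "\<And>m. m \<in> {1..K} \<Longrightarrow> int m dvd ?y"
  proof (rule zero_if_small_divisors)
    \<comment> \<open>Large enough that 4 ^ k exceeds the bound of \<open>lin_value_bound\<close>,
      and small enough that 2k + 1 is at most (2q + 3) (length w + 1).\<close>
    let ?k = "q * (length w + 1) + 1"
    have "2 * ?k + 1 \<le> K" using K(2) by (simp add: algebra_simps)
    then show "int m dvd ?y" if "1 \<le> m" "m \<le> 2 * ?k + 1" for m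
      using \<open>\<And>m. m \<in> {1..K} \<Longrightarrow> int m dvd ?y\<close>[of m] that by simp
    have "\<bar>?y\<bar> \<le> 2 ^ (q * (length w + 2))" by (rule lin_value_bound[OF t(3,4)])
    also have "\<dots> < (2 :: int) ^ (2 * ?k)" by (intro power_strict_increasing) (simp_all add: algebra_simps)
    also have "\<dots> = 4 ^ ?k" by (subst power_mult) simp
    finally show "\<bar>?y\<bar> < 4 ^ ?k" .
  qed
  then have "?f K = of_bool (d \<or> ?y \<noteq> 0)" by (auto simp: of_bool_def)
  then have 3: "\<exists>m p. ctrl K m (of_bool (d \<or> ?y \<noteq> 0)) p ow s \<and> p \<le> length w + 1" if "?I K s" for s
    using that by metis
  show ?thesis
    unfolding zero_test_def by (rule hoare_conseq[OF hoare_Seq[OF 1 2] _ 3])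
qed

lemma hoare_zero_tests:
  assumes "\<And>t. t \<in> set ts \<Longrightarrow> (\<forall>e\<in>set (fst t @ snd t). lin_in (set vs) e) \<and>
      length (fst t) \<le> q \<and> length (snd t) \<le> q"
    and K: "K \<le> b" "(2 * q + 3) * (length w + 1) \<le> K"
  shows "hoare w b (\<lambda>s. \<exists>m p. ctrl K m (of_bool d) p ow s \<and> p \<le> length w + 1)
    (block (map (zero_test vs as P z) ts))
    (\<lambda>s. \<exists>m p. ctrl K m (of_bool (d \<or> (\<exists>t\<in>set ts. lin_value P w t z \<noteq> 0))) p ow s \<and> p \<le> length w + 1)"
  using assms(1)
proof (induction ts arbitrary: d)
  case Nil
  show ?case by (simp add: block_def hoare_Skip)
next
  case (Cons t ts)
  let ?y = "lin_value P w t z"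
  have "hoare w b (\<lambda>s. \<exists>m p. ctrl K m (of_bool d) p ow s \<and> p \<le> length w + 1) (zero_test vs as P z t)
    (\<lambda>s. \<exists>m p. ctrl K m (of_bool (d \<or> ?y \<noteq> 0)) p ow s \<and> p \<le> length w + 1)"
    by (rule hoare_zero_test[OF _ _ _ _ K]) (use Cons.prems[of t] in auto)
  moreover have "hoare w b (\<lambda>s. \<exists>m p. ctrl K m (of_bool (d \<or> ?y \<noteq> 0)) p ow s \<and> p \<le> length w + 1)
    (block (map (zero_test vs as P z) ts))
    (\<lambda>s. \<exists>m p. ctrl K m (of_bool ((d \<or> ?y \<noteq> 0) \<or> (\<exists>t\<in>set ts. lin_value P w t z \<noteq> 0))) p ow s \<and>
      p \<le> length w + 1)"
    using Cons.prems by (intro Cons.IH) auto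
  ultimately have "hoare w b (\<lambda>s. \<exists>m p. ctrl K m (of_bool d) p ow s \<and> p \<le> length w + 1)
    (block (map (zero_test vs as P z) (t # ts)))
    (\<lambda>s. \<exists>m p. ctrl K m (of_bool ((d \<or> ?y \<noteq> 0) \<or> (\<exists>t\<in>set ts. lin_value P w t z \<noteq> 0))) p ow s \<and>
      p \<le> length w + 1)"
    unfolding block_def by (simp add: hoare_Seq)
  moreover have "((d \<or> ?y \<noteq> 0) \<or> (\<exists>t\<in>set ts. lin_value P w t z \<noteq> 0))
      = (d \<or> (\<exists>t\<in>set (t # ts). lin_value P w t z \<noteq> 0))" by auto
  ultimately show ?case by (simp only:)
qed

end

section \<open>Selecting output symbols by linear tests\<close>

definition output_test :: "'v list \<Rightarrow> 'a list \<Rightarrow> ('a \<Rightarrow> 'v lin list) \<Rightarrow> 'v \<Rightarrow>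
    ('b \<Rightarrow> ('v lin list \<times> 'v lin list) list) \<Rightarrow> 'b \<Rightarrow> ('v ctr, 'a, 'b) com" where
  "output_test vs as P z tests y = Prim (Zero Flag) ;; block (map (zero_test vs as P z) (tests y)) ;;
    Cond (Neq Flag Null) (Prim (Put y)) Skip"

text \<open>The block before the scan supplies the summand 1 in \<open>k * (length w + 1)\<close>;
  each letter adds another \<open>k\<close>.\<close>

definition set_limit :: "nat \<Rightarrow> ('v ctr, 'a, 'b) com" where
  "set_limit k = block (replicate k (Prim (Inc Limit))) ;;
    scan (block (replicate k (Prim (Inc Limit))))"

lemma hoare_add_limit:
  fixes w :: "'a list" and ow :: "'c list"
  assumes "K + k \<le> b"
  shows "hoare w b (ctrl K m f p ow) (block (replicate k (Prim (Inc Limit)))) (ctrl (K + k) m f p ow)"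
proof -
  let ?cs = "replicate k (Prim (Inc Limit)) :: ('b ctr, 'a, 'c) com list"
  have "hoare w b (ctrl (K + i) m f p ow) (?cs ! i) (ctrl (K + Suc i) m f p ow)"
    if "i < length ?cs" for i
    using that assms by (auto intro!: hoare_Prim simp: ctrl_def)
  then have "hoare w b (ctrl (K + 0) m f p ow) (block ?cs) (ctrl (K + length ?cs) m f p ow)"
    by (rule hoare_block)
  then show ?thesis by simp
qed

lemma hoare_set_limit:
  assumes b: "b = k * (length w + 1)"
  shows "hoare w b (ctrl 0 m f 0 ow) (set_limit k) (ctrl b m f (length w + 1) ow)"
proof -
  let ?I = "\<lambda>i s. \<exists>p. ctrl (k * Suc i) m f p ow s"
  have "hoare w b (ctrl 0 m f 0 ow) (block (replicate k (Prim (Inc Limit)))) (ctrl (0 + k) m f 0 ow)"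
    using b by (intro hoare_add_limit) simp
  then have "hoare w b (ctrl 0 m f 0 ow) (block (replicate k (Prim (Inc Limit)))) (\<lambda>s. ?I 0 s \<and> pos s = 0)"
    by (rule hoare_conseq) (auto simp: ctrl_def)
  moreover have "hoare w b (\<lambda>s. ?I 0 s \<and> pos s = 0) (scan (block (replicate k (Prim (Inc Limit)))))
      (\<lambda>s. ?I (length w) s \<and> pos s = length w + 1)"
  proof (rule hoare_scan)
    fix i assume i: "i < length w"
    have "k * Suc (Suc i) \<le> b" unfolding b using i by (intro mult_le_mono) auto
    then have "hoare w b (ctrl (k * Suc i) m f (Suc i) ow) (block (replicate k (Prim (Inc Limit))))
        (ctrl (k * Suc i + k) m f (Suc i) ow)"
      by (intro hoare_add_limit) simp
    then show "hoare w b (\<lambda>s. ?I i s \<and> pos s = Suc i) (block (replicate k (Prim (Inc Limit))))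
        (\<lambda>s. ?I (Suc i) s \<and> pos s = Suc i)"
      by (rule hoare_conseq) (auto simp: ctrl_def)
  qed (auto simp: ctrl_def)
  ultimately have "hoare w b (ctrl 0 m f 0 ow) (set_limit k) (\<lambda>s. ?I (length w) s \<and> pos s = length w + 1)"
    unfolding set_limit_def by (rule hoare_Seq)
  then show ?thesis by (rule hoare_conseq) (auto simp: ctrl_def b)
qed

lemma com_in_dispatch: "(\<And>a. a \<in> set as \<Longrightarrow> com_in R B (f a)) \<Longrightarrow> com_in R B (dispatch f as)"
  by (induction as) auto

lemma com_in_lin_codes:
  assumes "\<And>e. e \<in> set ops \<Longrightarrow> lin_in V e" "Var ` V \<subseteq> R" "Aux \<in> R"
  shows "com_in R B (lin_codes ops)"
  unfolding lin_codes_def com_in_block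
proof
  fix c :: "('a ctr, 'c, 'b) com" assume "c \<in> set (map lin_code ops)"
  then obtain e where e: "c = lin_code e" "lin_in V e" using assms(1) by auto
  then show "com_in R B c" using assms(2,3) by (cases e) (auto simp: mod_inc_def)
qed

theorem logspace_linear_tests:
  fixes P :: "'a \<Rightarrow> 'v lin list" and tests :: "'b \<Rightarrow> ('v lin list \<times> 'v lin list) list"
  assumes "finite V" "finite A" "z \<in> V"
    and P: "\<And>a e. a \<in> A \<Longrightarrow> e \<in> set (P a) \<Longrightarrow> lin_in V e"
    and tests: "\<And>y t e. y \<in> set ys \<Longrightarrow> t \<in> set (tests y) \<Longrightarrow> e \<in> set (fst t @ snd t) \<Longrightarrow> lin_in V e"
  shows "\<exists>T :: (nat, nat, 'a, 'b) transducer. logspace_transducer A (set ys) T \<and>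
    (\<forall>w\<in>lists A. computes T w (filter (\<lambda>y. \<exists>t\<in>set (tests y). lin_value P w t z \<noteq> 0) ys))"
proof -
  obtain vs where vs: "set vs = V" using finite_list[OF assms(1)] by blast
  obtain as where as: "set as = A" using finite_list[OF assms(2)] by blast
  define L where "L = P ` set as \<union> (\<Union>y\<in>set ys. \<Union>t\<in>set (tests y). {fst t, snd t})"
  define q where "q = Max (insert 0 (length ` L))"
  have "finite L" unfolding L_def by auto
  then have q: "length l \<le> q" if "l \<in> L" for l
    unfolding q_def using that by (intro Max_ge) auto
  \<comment> \<open>The factor demanded by \<open>hoare_zero_test\<close>; the last modulus and the
    bound on all counters are then the same number.\<close>
  define k where "k = 2 * q + 3"
  define R where "R = {Null, Limit, Modulus, Flag, Aux} \<union> Var ` V"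
  define prog where "prog = set_limit k ;; block (map (output_test vs as P z tests) ys)"
  show ?thesis
  proof (rule logspace_program[where R = R and p = prog and K = k])
    show "finite R" using assms(1) by (simp add: R_def)
    have "com_in R (set ys) (output_test vs as P z tests y)" if y: "y \<in> set ys" for y
    proof -
      have "com_in R (set ys) (zero_test vs as P z t)" if t: "t \<in> set (tests y)" for t
      proof -
        have "com_in R (set ys) (lin_codes (fst t))" "com_in R (set ys) (lin_codes (snd t))"
          using tests[OF y t] by (auto intro!: com_in_lin_codes[where V = V] simp: R_def)
        moreover have "com_in R (set ys) (dispatch (\<lambda>a. lin_codes (P a)) as)"
          using P as by (intro com_in_dispatch com_in_lin_codes[where V = V]) (auto simp: R_def)
        moreover have "com_in R (set ys) (clear vs)"
          using vs by (auto simp: clear_def com_in_block R_def)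
        ultimately show ?thesis
          by (simp add: zero_test_def trial_def rewind_def scan_def) (simp add: R_def)
      qed
      then show ?thesis using y by (auto simp: output_test_def com_in_block R_def)
    qed
    then show "com_in R (set ys) prog"
      by (auto simp: prog_def com_in_block set_limit_def scan_def R_def)
  next
    fix w assume w: "w \<in> lists A"
    let ?b = "k * (length w + 1)"
    let ?sel = "\<lambda>y. \<exists>t\<in>set (tests y). lin_value P w t z \<noteq> 0"
    let ?I = "\<lambda>i s. \<exists>m f p. ctrl ?b m f p (filter ?sel (take i ys)) s \<and> p \<le> length w + 1"
    have step: "hoare w ?b (?I i) (output_test vs as P z tests y) (?I (Suc i))"
      if i: "i < length ys" and y: "y = ys ! i" for i y
    proof -
      let ?ow = "filter ?sel (take i ys)"
      have ys: "y \<in> set ys" using i y by simp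
      have ts: "(\<forall>e\<in>set (fst t @ snd t). lin_in (set vs) e) \<and> length (fst t) \<le> q \<and> length (snd t) \<le> q"
        if "t \<in> set (tests y)" for t
      proof -
        have "fst t \<in> L" "snd t \<in> L" unfolding L_def using ys that by blast+
        then show ?thesis using tests[OF ys that] q vs by blast
      qed
      have 1: "hoare w ?b (?I i) (Prim (Zero Flag))
          (\<lambda>s. \<exists>m p. ctrl ?b m (of_bool False) p ?ow s \<and> p \<le> length w + 1)"
        by (rule hoare_Prim) (auto simp: ctrl_def)
      have 2: "hoare w ?b (\<lambda>s. \<exists>m p. ctrl ?b m (of_bool False) p ?ow s \<and> p \<le> length w + 1)
          (block (map (zero_test vs as P z) (tests y)))
          (\<lambda>s. \<exists>m p. ctrl ?b m (of_bool (False \<or> ?sel y)) p ?ow s \<and> p \<le> length w + 1)"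
      proof (rule hoare_zero_tests[where q = q])
        show "length (P a) \<le> q" if "a \<in> set as" for a using that q unfolding L_def by simp
      qed (use P vs as assms(3) w ts k_def in auto)
      have 3: "hoare w ?b (\<lambda>s. \<exists>m p. ctrl ?b m (of_bool (False \<or> ?sel y)) p ?ow s \<and> p \<le> length w + 1)
          (Cond (Neq Flag Null) (Prim (Put y)) Skip) (?I (Suc i))"
        using i y by (intro hoare_Cond hoare_Prim hoare_Skip)
          (auto simp: ctrl_def take_Suc_conv_app_nth)
      show ?thesis
        unfolding output_test_def by (rule hoare_Seq[OF 1 hoare_Seq[OF 2 3]])
    qed
    have 2: "hoare w ?b (?I 0) (block (map (output_test vs as P z tests) ys)) (?I (length ys))"
      using hoare_block[of "map (output_test vs as P z tests) ys" w ?b ?I] step by simp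
    have 1: "hoare w ?b (ctrl 0 0 0 0 []) (set_limit k) (?I 0)"
      by (rule hoare_conseq[OF hoare_set_limit[OF HOL.refl]]) (auto simp: ctrl_def)
    have "hoare w ?b (ctrl 0 0 0 0 []) prog (?I (length ys))"
      unfolding prog_def by (rule hoare_Seq[OF 1 2])
    moreover have "ctrl 0 0 0 0 [] \<lparr>reg = \<lambda>_. 0, pos = 0, out = []\<rparr>" by (simp add: ctrl_def)
    ultimately obtain s' where "exec w ?b prog \<lparr>reg = \<lambda>_. 0, pos = 0, out = []\<rparr> s'" "?I (length ys) s'"
      unfolding hoare_def by blast
    then show "\<exists>s'. exec w ?b prog \<lparr>reg = \<lambda>_. 0, pos = 0, out = []\<rparr> s' \<and> out s' = filter ?sel ys"
      by (auto simp: ctrl_def)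
  qed (use assms(2) k_def in auto)
qed


section \<open>The geometric representation of a Coxeter group\<close>

text \<open>This is -2 B(alpha_i, alpha_j) for the standard bilinear form B; the entry 0 means
  infinity and gets the limit value 2.\<close>

definition weight :: "(nat \<Rightarrow> nat \<Rightarrow> nat) \<Rightarrow> nat \<Rightarrow> nat \<Rightarrow> real" where
  "weight M i j = (if M i j = 0 then 2 else 2 * cos (pi / M i j))"

text \<open>
  A linear functional on the geometric representation is given by its values on the simple roots;
  the group acts on functionals from the right.  For \<open>M a a = 1\<close> the weight of the diagonal is
  \<open>-2\<close>, so that the formula also negates the value at \<open>a\<close>.
\<close>

definition reflect :: "(nat \<Rightarrow> nat \<Rightarrow> nat) \<Rightarrow> nat \<Rightarrow> (nat \<Rightarrow> real) \<Rightarrow> nat \<Rightarrow> real" where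
  "reflect M a f = (\<lambda>j. f j + weight M a j * f a)"

abbreviation act :: "(nat \<Rightarrow> nat \<Rightarrow> nat) \<Rightarrow> nat list \<Rightarrow> (nat \<Rightarrow> real) \<Rightarrow> nat \<Rightarrow> real" where
  "act M u \<equiv> fold (reflect M) u"

lemma weight_diag: "M a a = 1 \<Longrightarrow> weight M a a = -2"
  by (simp add: weight_def)

lemma reflect_reflect: "M a a = 1 \<Longrightarrow> reflect M a (reflect M a f) = f"
  by (simp add: reflect_def weight_diag fun_eq_iff)

lemma reflect_fixed: "f a = 0 \<Longrightarrow> reflect M a f = f"
  by (simp add: reflect_def)

section \<open>Alternating words and dihedral subgroups\<close>

fun alt :: "'a \<Rightarrow> 'a \<Rightarrow> nat \<Rightarrow> 'a list" where
  "alt x y 0 = []"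
| "alt x y (Suc k) = x # alt y x k"

lemma length_alt [simp]: "length (alt x y k) = k"
  by (induction k arbitrary: x y) auto

lemma set_alt: "set (alt x y k) \<subseteq> {x, y}"
  by (induction k arbitrary: x y) auto

lemma alt_add: "alt x y (j + k) = alt x y j @ (if even j then alt x y k else alt y x k)"
  by (induction j arbitrary: x y) auto

lemma alt_Suc: "alt x y (Suc k) = alt x y k @ [if even k then x else y]"
  using alt_add[of x y k 1] by simp

lemma alt_double: "alt x y (2 * k) = concat (replicate k [x, y])"
  by (induction k) auto

lemma distinct_adj_alt:
  assumes "distinct_adj u" "set u \<subseteq> {s, t}"
  shows "u = alt s t (length u) \<or> u = alt t s (length u)"
  using assms
proof (induction u)
  case (Cons a u)
  show ?case
  proof (cases u)
    case Nil
    then show ?thesis using Cons.prems by auto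
  next
    case (Cons b v)
    have "u = alt s t (length u) \<or> u = alt t s (length u)" "a \<noteq> b" "a \<in> {s, t}"
      using Cons.IH Cons.prems Cons by auto
    then show ?thesis using Cons by auto
  qed
qed simp

lemma not_distinct_adj_decomp: "\<not> distinct_adj u \<Longrightarrow> \<exists>p a q. u = p @ [a, a] @ q"
proof (induction u)
  case (Cons b u)
  then obtain c v where u: "u = c # v" by (cases u) auto
  show ?case
  proof (cases "b = c")
    case True
    then show ?thesis using u by (intro exI[of _ "[]"]) auto
  next
    case False
    then obtain p a q where "u = p @ [a, a] @ q" using Cons u by auto
    then show ?thesis by (intro exI[of _ "b # p"]) auto
  qed
qed simp

text \<open>
  Alternately reflecting in two simple roots only involves the values at these two roots:
  \<open>dih c p q t\<close> is the value at the root of the next reflection after \<open>t\<close> reflections.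
\<close>

fun dih :: "real \<Rightarrow> real \<Rightarrow> real \<Rightarrow> nat \<Rightarrow> real" where
  "dih c p q 0 = p"
| "dih c p q (Suc t) = dih c (q + c * p) (- p) t"

lemma act_alt:
  assumes "M x x = 1" "M y y = 1" "M x y = M y x"
  shows "act M (alt x y k) f z
    = f z + (\<Sum>t<k. weight M (if even t then x else y) z * dih (weight M x y) (f x) (f y) t)"
  using assms
proof (induction k arbitrary: x y f)
  case (Suc k)
  have w: "weight M y x = weight M x y" using Suc.prems by (simp add: weight_def)
  have "act M (alt x y (Suc k)) f z = act M (alt y x k) (reflect M x f) z" by simp
  also have "\<dots> = reflect M x f z + (\<Sum>t<k. weight M (if even t then y else x) z *
      dih (weight M y x) (reflect M x f y) (reflect M x f x) t)"
    using Suc.prems by (intro Suc.IH) auto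
  also have "\<dots> = f z + weight M x z * f x + (\<Sum>t<k. weight M (if even (Suc t) then x else y) z *
      dih (weight M x y) (f x) (f y) (Suc t))"
    using Suc.prems by (auto simp: w reflect_def weight_diag intro!: sum.cong)
  finally show ?case by (subst sum.lessThan_Suc_shift) simp
qed simp

lemma act_alt_next:
  assumes "M x x = 1" "M y y = 1" "M x y = M y x"
  shows "act M (alt x y k) f (if even k then x else y) = dih (weight M x y) (f x) (f y) k"
  using assms
proof (induction k arbitrary: x y f)
  case (Suc k)
  have w: "weight M y x = weight M x y" using Suc.prems by (simp add: weight_def)
  have "act M (alt y x k) (reflect M x f) (if even k then y else x)
      = dih (weight M y x) (reflect M x f y) (reflect M x f x) k"
    using Suc.prems by (intro Suc.IH) auto
  moreover have "reflect M x f x = - f x" "reflect M x f y = f y + weight M x y * f x"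
    using Suc.prems by (simp_all add: reflect_def weight_diag)
  ultimately show ?case by (auto simp: w)
qed simp

lemma dih_2: "dih 2 p q t = (real t + 1) * p + real t * q"
  by (induction t arbitrary: p q) (auto simp: algebra_simps)

text \<open>In terms of Chebyshev polynomials of the second kind at cos \<theta>, the value is p U_t
  + q U_(t-1); multiplying by sin \<theta> avoids the division.\<close>

lemma dih_cos:
  "sin \<theta> * dih (2 * cos \<theta>) p q t = p * sin ((real t + 1) * \<theta>) + q * sin (real t * \<theta>)"
proof (induction t arbitrary: p q)
  case (Suc t)
  have "2 * cos \<theta> * sin ((real t + 1) * \<theta>)
      = sin ((real t + 1) * \<theta> + \<theta>) + sin ((real t + 1) * \<theta> - \<theta>)"
    by (simp add: sin_add sin_diff)
  also have "(real t + 1) * \<theta> + \<theta> = (real (Suc t) + 1) * \<theta>" by (simp add: algebra_simps)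
  also have "(real t + 1) * \<theta> - \<theta> = real t * \<theta>" by (simp add: algebra_simps)
  finally have *: "2 * cos \<theta> * sin ((real t + 1) * \<theta>)
      = sin ((real (Suc t) + 1) * \<theta>) + sin (real t * \<theta>)" .
  have "sin \<theta> * dih (2 * cos \<theta>) p q (Suc t)
      = q * sin ((real t + 1) * \<theta>) + p * (2 * cos \<theta> * sin ((real t + 1) * \<theta>)) - p * sin (real t * \<theta>)"
    using Suc.IH[of "q + 2 * cos \<theta> * p" "- p"] by (simp add: algebra_simps)
  then show ?case unfolding * by (simp add: algebra_simps)
qed (simp add: mult.commute)

text \<open>The angles are equally spaced round the circle. After multiplication by 2 sin \<theta>,
  which is positive for \<open>m\<close> at least 2, the sum telescopes.\<close>

lemma sum_sin_period:
  assumes "m \<ge> 2"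
  shows "(\<Sum>t<m. sin (2 * real t * (pi / real m) + \<phi>)) = 0"
proof -
  define \<theta> where "\<theta> = pi / real m"
  have "0 < \<theta>" "\<theta> < pi" using assms by (auto simp: \<theta>_def field_simps)
  then have s: "sin \<theta> > 0" by (rule sin_gt_zero)
  have "2 * sin \<theta> * sin (2 * real t * \<theta> + \<phi>)
      = cos ((2 * real t - 1) * \<theta> + \<phi>) - cos ((2 * real (Suc t) - 1) * \<theta> + \<phi>)" for t
  proof -
    have "2 * sin \<theta> * sin (2 * real t * \<theta> + \<phi>)
        = cos ((2 * real t * \<theta> + \<phi>) - \<theta>) - cos ((2 * real t * \<theta> + \<phi>) + \<theta>)"
      by (simp add: cos_add cos_diff)
    then show ?thesis by (simp add: algebra_simps)
  qed
  then have "2 * sin \<theta> * (\<Sum>t<m. sin (2 * real t * \<theta> + \<phi>))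
      = (\<Sum>t<m. cos ((2 * real t - 1) * \<theta> + \<phi>) - cos ((2 * real (Suc t) - 1) * \<theta> + \<phi>))"
    by (simp add: sum_distrib_left)
  also have "\<dots> = cos (- \<theta> + \<phi>) - cos ((2 * real m - 1) * \<theta> + \<phi>)"
    by (subst sum_lessThan_telescope') simp
  also have "(2 * real m - 1) * \<theta> + \<phi> = (- \<theta> + \<phi>) + 2 * pi"
    using assms by (simp add: \<theta>_def algebra_simps)
  also have "cos ((- \<theta> + \<phi>) + 2 * pi) = cos (- \<theta> + \<phi>)" by (rule cos_periodic)
  finally show ?thesis using s by (simp add: \<theta>_def)
qed

text \<open>Even and odd steps reflect in different roots and carry different weights in
  \<open>act_alt\<close>, so each half must vanish separately.\<close>

lemma dih_period:
  assumes "m \<ge> 2"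
  shows "(\<Sum>t<m. dih (2 * cos (pi / real m)) p q (2 * t)) = 0"
    and "(\<Sum>t<m. dih (2 * cos (pi / real m)) p q (2 * t + 1)) = 0"
proof -
  let ?\<theta> = "pi / real m"
  have "0 < ?\<theta>" "?\<theta> < pi" using assms by (auto simp: field_simps)
  then have s: "sin ?\<theta> > 0" by (rule sin_gt_zero)
  have *: "(\<Sum>t<m. dih (2 * cos ?\<theta>) p q (2 * t)) = 0" for p q
  proof -
    have "sin ?\<theta> * (\<Sum>t<m. dih (2 * cos ?\<theta>) p q (2 * t))
        = p * (\<Sum>t<m. sin (2 * real t * ?\<theta> + ?\<theta>)) + q * (\<Sum>t<m. sin (2 * real t * ?\<theta> + 0))"
      unfolding sum_distrib_left dih_cos sum.distrib[symmetric]
      by (intro sum.cong) (auto simp: algebra_simps)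
    then show ?thesis using s by (simp only: sum_sin_period[OF assms]) simp
  qed
  show "(\<Sum>t<m. dih (2 * cos ?\<theta>) p q (2 * t)) = 0" by (rule *)
  show "(\<Sum>t<m. dih (2 * cos ?\<theta>) p q (2 * t + 1)) = 0" using * by simp
qed

lemma sum_lessThan_double:
  fixes g :: "nat \<Rightarrow> 'a::comm_monoid_add"
  shows "(\<Sum>t<2 * m. g t) = (\<Sum>t<m. g (2 * t)) + (\<Sum>t<m. g (2 * t + 1))"
  by (induction m) (auto simp: algebra_simps)

lemma act_braid:
  assumes "M x x = 1" "M y y = 1" "M x y = M y x" "M x y \<noteq> 1"
  shows "act M (alt x y (2 * M x y)) f = f"
proof (cases "M x y = 0")
  case False
  then have m: "M x y \<ge> 2" using assms by linarith
  have w: "weight M x y = 2 * cos (pi / real (M x y))" using False by (simp add: weight_def)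
  show ?thesis
    by (rule ext, subst act_alt[OF assms(1-3)], subst sum_lessThan_double)
      (use dih_period[OF m] in \<open>simp add: w flip: sum_distrib_left\<close>)
qed simp

text \<open>For \<open>k\<close> below m the angles k pi / m and (k + 1) pi / m lie in [0, pi], so
  both sines in \<open>dih_cos\<close> are nonnegative.\<close>

lemma dih_nonneg:
  assumes "p \<ge> 0" "q \<ge> 0" "M x y \<noteq> 1" "M x y = 0 \<or> k < M x y"
  shows "dih (weight M x y) p q k \<ge> 0"
proof (cases "M x y = 0")
  case True
  then show ?thesis using assms by (simp add: weight_def dih_2)
next
  case False
  define m where "m = M x y"
  have m: "m \<ge> 2" "k < m" using False assms by (auto simp: m_def)
  let ?\<theta> = "pi / real m"
  have "0 < ?\<theta>" "?\<theta> < pi" using m by (auto simp: field_simps)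
  then have s: "sin ?\<theta> > 0" by (rule sin_gt_zero)
  have "sin (real j * ?\<theta>) \<ge> 0" if "j \<le> m" for j
    using that m by (intro sin_ge_zero) (auto simp: field_simps)
  from this[of k] this[of "Suc k"]
  have "sin ?\<theta> * dih (2 * cos ?\<theta>) p q k \<ge> 0"
    unfolding dih_cos using assms m by (simp add: add.commute)
  then have "dih (2 * cos ?\<theta>) p q k \<ge> 0"
    using s by (simp add: zero_le_mult_iff)
  then show ?thesis using False by (simp add: weight_def m_def)
qed

section \<open>Words up to equality in the Coxeter group, and their action on functionals\<close>

definition word_rel :: "nat \<Rightarrow> (nat \<Rightarrow> nat \<Rightarrow> nat) \<Rightarrow> nat list \<Rightarrow> nat list \<Rightarrow> bool" where
  "word_rel n M u v \<longleftrightarrow>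
    (map (Pair True) u, map (Pair True) v) \<in> pres_rel {1..n} (coxeter_relators n M)"

definition geodesic :: "nat \<Rightarrow> (nat \<Rightarrow> nat \<Rightarrow> nat) \<Rightarrow> nat list \<Rightarrow> bool" where
  "geodesic n M u \<longleftrightarrow> u \<in> lists {1..n} \<and> (\<forall>v. word_rel n M u v \<longrightarrow> length u \<le> length v)"

context
  fixes n :: nat and M :: "nat \<Rightarrow> nat \<Rightarrow> nat"
  assumes cox: "coxeter_matrix n M"
begin

lemma cox_diag: "a \<in> {1..n} \<Longrightarrow> M a a = 1"
  and cox_sym: "a \<in> {1..n} \<Longrightarrow> b \<in> {1..n} \<Longrightarrow> M a b = M b a"
  and cox_neq: "a \<in> {1..n} \<Longrightarrow> b \<in> {1..n} \<Longrightarrow> a \<noteq> b \<Longrightarrow> M a b \<noteq> 1"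
  using cox unfolding coxeter_matrix_def by blast+

lemma map_Pair_lists: "map (Pair True) u \<in> lists (UNIV \<times> {1..n}) \<longleftrightarrow> u \<in> lists {1..n}"
  by (auto simp: in_lists_conv_set)

lemma word_rel_lists: "word_rel n M u v \<Longrightarrow> u \<in> lists {1..n} \<and> v \<in> lists {1..n}"
  unfolding word_rel_def by (drule pres_rel_lists) (simp only: map_Pair_lists)

lemma word_rel_refl: "u \<in> lists {1..n} \<Longrightarrow> word_rel n M u u"
  unfolding word_rel_def by (intro pres_rel.refl) (simp only: map_Pair_lists)

lemma word_rel_sym: "word_rel n M u v \<Longrightarrow> word_rel n M v u"
  unfolding word_rel_def by (rule pres_rel.sym)

lemma word_rel_trans: "word_rel n M u v \<Longrightarrow> word_rel n M v w \<Longrightarrow> word_rel n M u w"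
  unfolding word_rel_def by (rule pres_rel.trans)

lemma word_rel_append:
  "word_rel n M u u' \<Longrightarrow> word_rel n M v v' \<Longrightarrow> word_rel n M (u @ v) (u' @ v')"
  unfolding word_rel_def by (simp add: pres_rel_append)

lemma word_rel_context:
  "word_rel n M u u' \<Longrightarrow> p \<in> lists {1..n} \<Longrightarrow> q \<in> lists {1..n} \<Longrightarrow>
    word_rel n M (p @ u @ q) (p @ u' @ q)"
  by (intro word_rel_append word_rel_refl)

lemma word_rel_braid:
  assumes "x \<in> {1..n}" "y \<in> {1..n}"
  shows "word_rel n M (alt x y (2 * M x y)) []"
proof -
  let ?r = "concat (replicate (M x y) [(True, x), (True, y)])"
  have "map (Pair True) (alt x y (2 * M x y)) = ?r"
    by (simp add: alt_double map_concat)
  moreover have "([] @ ?r @ [], [] @ []) \<in> pres_rel {1..n} (coxeter_relators n M)"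
  proof (rule pres_rel.relator)
    show "?r \<in> coxeter_relators n M" using assms unfolding coxeter_relators_def by blast
    show "[] @ ?r @ [] \<in> lists (UNIV \<times> {1..n})" using assms by (auto simp: in_lists_conv_set)
  qed
  ultimately show ?thesis by (simp add: word_rel_def)
qed

lemma word_rel_square: "x \<in> {1..n} \<Longrightarrow> word_rel n M [x, x] []"
  using word_rel_braid[of x x] cox_diag[of x] by (simp add: numeral_2_eq_2)

lemma word_rel_rev: "u \<in> lists {1..n} \<Longrightarrow> word_rel n M (u @ rev u) []"
proof (induction u)
  case (Cons a u)
  then have "word_rel n M ([a] @ (u @ rev u) @ [a]) ([a] @ [] @ [a])"
    by (intro word_rel_context) auto
  then have "word_rel n M ((a # u) @ rev (a # u)) [a, a]" by simp
  moreover have "word_rel n M [a, a] []" using Cons.prems by (intro word_rel_square) simp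
  ultimately show ?case by (rule word_rel_trans)
qed (simp add: word_rel_refl)

lemma word_rel_inverse:
  assumes "word_rel n M (u @ v) []"
  shows "word_rel n M u (rev v)"
proof -
  have uv: "u \<in> lists {1..n}" "v \<in> lists {1..n}" using word_rel_lists[OF assms] by auto
  then have rv: "rev v \<in> lists {1..n}" by auto
  have 1: "word_rel n M (u @ v @ rev v) u"
    using word_rel_append[OF word_rel_refl[OF uv(1)] word_rel_rev[OF uv(2)]] by simp
  have 2: "word_rel n M (u @ v @ rev v) (rev v)"
    using word_rel_append[OF assms word_rel_refl[OF rv]] by simp
  show ?thesis by (rule word_rel_trans[OF word_rel_sym[OF 1] 2])
qed

lemma word_rel_snoc:
  assumes "word_rel n M (u @ [s]) v" "s \<in> {1..n}"
  shows "word_rel n M u (v @ [s])"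
proof -
  have u: "u \<in> lists {1..n}" using word_rel_lists[OF assms(1)] by auto
  have 1: "word_rel n M (u @ [s, s]) (v @ [s])"
    using word_rel_append[OF assms(1) word_rel_refl[of "[s]"]] assms(2) by simp
  have 2: "word_rel n M (u @ [s, s]) u"
    using word_rel_append[OF word_rel_refl[OF u] word_rel_square[OF assms(2)]] by simp
  show ?thesis by (rule word_rel_trans[OF word_rel_sym[OF 2] 1])
qed

text \<open>In the relator of length 2m, the first m + 1 letters equal the reverse of the remaining
  m - 1, which saves two letters.\<close>

lemma word_rel_alt_long:
  assumes "x \<in> {1..n}" "y \<in> {1..n}" "M x y \<noteq> 0" "M x y < k"
  obtains v where "word_rel n M (alt x y k) v" "length v + 2 = k"
proof -
  let ?m = "M x y"
  define p where "p = (if even (?m + 1) then alt x y (?m - 1) else alt y x (?m - 1))"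
  define q where
    "q = (if even (?m + 1) then alt x y (k - (?m + 1)) else alt y x (k - (?m + 1)))"
  have "2 * ?m = (?m + 1) + (?m - 1)" using assms(3) by simp
  then have p: "alt x y (2 * ?m) = alt x y (?m + 1) @ p" unfolding p_def by (simp only: alt_add)
  have "k = (?m + 1) + (k - (?m + 1))" using assms(4) by simp
  then have q: "alt x y k = alt x y (?m + 1) @ q" unfolding q_def by (metis alt_add)
  have "word_rel n M (alt x y (?m + 1) @ p) []"
    using word_rel_braid[OF assms(1,2)] unfolding p .
  then have "word_rel n M (alt x y (?m + 1)) (rev p)" by (rule word_rel_inverse)
  moreover have "set q \<subseteq> {x, y}"
    using set_alt[of x y] set_alt[of y x] unfolding q_def by auto
  then have "q \<in> lists {1..n}" using assms(1,2) by auto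
  ultimately have "word_rel n M (alt x y k) (rev p @ q)"
    unfolding q by (intro word_rel_append word_rel_refl)
  moreover have "length (rev p @ q) + 2 = k" using assms(3,4) by (auto simp: p_def q_def)
  ultimately show ?thesis by (rule that)
qed

lemma pres_rel_act:
  assumes "(u, v) \<in> pres_rel {1..n} (coxeter_relators n M)"
  shows "act M (map snd u) f = act M (map snd v) f"
  using assms
proof (induction arbitrary: f rule: pres_rel.induct)
  case (cancel u b x v)
  then have "M x x = 1" by (intro cox_diag) auto
  then show ?case by (simp add: reflect_reflect)
next
  case (relator u r v)
  then obtain i j where r: "r = concat (replicate (M i j) [(True, i), (True, j)])"
      and ij: "i \<in> {1..n}" "j \<in> {1..n}"
    unfolding coxeter_relators_def by blast
  have r': "map snd r = alt i j (2 * M i j)"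
    by (simp add: r alt_double map_concat)
  have "act M (map snd r) g = g" for g
  proof (cases "i = j")
    case True
    then show ?thesis using ij cox_diag[of j] by (simp add: r' reflect_reflect numeral_2_eq_2)
  next
    case False
    then show ?thesis
      unfolding r' using ij by (intro act_braid cox_diag cox_sym cox_neq)
  qed
  then show ?case by simp
qed simp_all

lemma word_rel_act: "word_rel n M u v \<Longrightarrow> act M u f = act M v f"
  using pres_rel_act[of "map (Pair True) u" "map (Pair True) v" f]
  by (simp add: word_rel_def comp_def)

lemma geodesic_butlast:
  assumes "geodesic n M (u @ [s])"
  shows "geodesic n M u"
  unfolding geodesic_def
proof (intro conjI allI impI)
  show "u \<in> lists {1..n}" using assms by (auto simp: geodesic_def)
  fix v assume "word_rel n M u v"
  then have "word_rel n M (u @ [s]) (v @ [s])"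
    using assms by (intro word_rel_append word_rel_refl) (auto simp: geodesic_def)
  then show "length u \<le> length v" using assms by (force simp: geodesic_def)
qed

text \<open>
  The root \<open>w \<alpha>\<^sub>s\<close> is nonnegative if \<open>l(ws) \<ge> l(w)\<close>.  For \<open>w\<close> ending in \<open>t\<close> one splits \<open>w = v x\<close> with \<open>x\<close> in the dihedral group of
  \<open>s, t\<close>, lengths adding up, and \<open>v\<close> as short as possible; induction applies to \<open>v\<close>.
\<close>

lemma act_nonneg:
  assumes "geodesic n M w" "s \<in> {1..n}"
    and "\<And>v. word_rel n M (w @ [s]) v \<Longrightarrow> length w \<le> length v"
    and f: "\<And>j. j \<in> {1..n} \<Longrightarrow> f j \<ge> 0"
  shows "act M w f s \<ge> 0"
  using assms(1-3)
proof (induction "length w" arbitrary: w s rule: less_induct)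
  case less
  have wl: "w \<in> lists {1..n}" and wmin: "\<And>v. word_rel n M w v \<Longrightarrow> length w \<le> length v"
    using less.prems(1) by (auto simp: geodesic_def)
  show ?case
  proof (cases w rule: rev_cases)
    case Nil
    then show ?thesis using f less.prems(2) by simp
  next
    case (snoc w' t)
    have tn: "t \<in> {1..n}" and w'l: "w' \<in> lists {1..n}" using wl snoc by auto
    note sn = less.prems(2)
    let ?Q = "\<lambda>v. \<exists>x. set x \<subseteq> {s, t} \<and> word_rel n M w (v @ x) \<and> length v + length x = length w"
    have Qw': "?Q w'"
      by (intro exI[of _ "[t]"]) (use snoc wl word_rel_refl in auto)
    define v where "v = arg_min length ?Q"
    have Qv: "?Q v" and vmin: "\<And>v'. ?Q v' \<Longrightarrow> length v \<le> length v'"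
      using arg_min_nat_lemma[of ?Q w' length] Qw' unfolding v_def by auto
    from Qv obtain x where x: "set x \<subseteq> {s, t}" "word_rel n M w (v @ x)"
        "length v + length x = length w" by blast
    have xl: "x \<in> lists {1..n}" and vl: "v \<in> lists {1..n}"
      using word_rel_lists[OF x(2)] by auto
    have vgeo: "geodesic n M v"
      unfolding geodesic_def
    proof (intro conjI allI impI)
      fix v' assume "word_rel n M v v'"
      then have "word_rel n M (v @ x) (v' @ x)"
        using xl by (intro word_rel_append word_rel_refl)
      then show "length v \<le> length v'"
        using x(3) wmin[OF word_rel_trans[OF x(2)], of "v' @ x"] by simp
    qed (use vl in auto)
    \<comment> \<open>If \<open>r\<close> shortened \<open>v\<close>, it could be moved over to
      \<open>x\<close>, contradicting the choice of \<open>v\<close>. So the induction hypothesis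
      applies to \<open>v\<close> with both \<open>s\<close> and \<open>t\<close>.\<close>
    have vup: "length v \<le> length v'" if r: "r \<in> {s, t}" and v': "word_rel n M (v @ [r]) v'" for r v'
    proof (rule ccontr)
      assume less: "\<not> length v \<le> length v'"
      have rn: "r \<in> {1..n}" using r sn tn by blast
      have "word_rel n M v (v' @ [r])" using v' rn by (rule word_rel_snoc)
      then have "word_rel n M (v @ x) ((v' @ [r]) @ x)"
        using xl by (intro word_rel_append word_rel_refl)
      then have *: "word_rel n M w (v' @ r # x)" using word_rel_trans[OF x(2)] by simp
      then have "length w \<le> length v' + 1 + length x" using wmin by fastforce
      then have "length v' + length (r # x) = length w" using less x(3) by simp
      then have "?Q v'" using * r x(1) by (intro exI[of _ "r # x"]) auto
      then show False using vmin less by blast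
    qed
    have "length v < length w" using vmin[OF Qw'] snoc by simp
    then have g: "act M v f s \<ge> 0" "act M v f t \<ge> 0"
      using less.hyps[of v s] less.hyps[of v t] vgeo sn tn vup by blast+
    have wsnoc: "word_rel n M (w @ [s]) (v @ (x @ [s]))"
      using word_rel_append[OF x(2) word_rel_refl[of "[s]"]] sn by simp
    \<comment> \<open>Equal neighbours would cancel and make \<open>w @ [s]\<close> equal to a word
      shorter than \<open>w\<close>. Hence \<open>x @ [s]\<close> alternates.\<close>
    have nadj: "distinct_adj (x @ [s])"
    proof (rule ccontr)
      assume "\<not> distinct_adj (x @ [s])"
      then obtain x1 a x2 where d: "x @ [s] = x1 @ [a, a] @ x2"
        using not_distinct_adj_decomp by blast
      have "x1 @ [a, a] @ x2 \<in> lists {1..n}" unfolding d[symmetric] using xl sn by auto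
      then have "word_rel n M (x1 @ [a, a] @ x2) (x1 @ [] @ x2)"
        by (intro word_rel_context word_rel_square) auto
      then have "word_rel n M (v @ x @ [s]) (v @ x1 @ x2)"
        using word_rel_append[OF word_rel_refl[OF vl]] unfolding d by simp
      then have "word_rel n M (w @ [s]) (v @ x1 @ x2)" by (rule word_rel_trans[OF wsnoc])
      then have "length w \<le> length v + length x1 + length x2"
        using less.prems(3) by fastforce
      moreover have "length x + 1 = length x1 + 2 + length x2"
        using arg_cong[OF d, of length] by simp
      ultimately show False using x(3) by simp
    qed
    define k where "k = length x"
    obtain a b where ab: "a = s \<and> b = t \<or> a = t \<and> b = s" and xs: "x @ [s] = alt a b (Suc k)"
      using distinct_adj_alt[OF nadj, of s t] x(1) by (auto simp: k_def)
    have xk: "x = alt a b k" and sk: "s = (if even k then a else b)"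
      using xs unfolding alt_Suc by auto
    have abn: "a \<in> {1..n}" "b \<in> {1..n}" using ab sn tn by auto
    \<comment> \<open>Otherwise the relator shortens \<open>x @ [s]\<close> by two letters, with the
      same contradiction. This is the range in which \<open>dih_nonneg\<close> applies.\<close>
    have "k < M a b" if nz: "M a b \<noteq> 0"
    proof (rule ccontr)
      assume "\<not> k < M a b"
      then obtain y where y: "word_rel n M (alt a b (Suc k)) y" "length y + 2 = Suc k"
        using word_rel_alt_long[OF abn nz, of "Suc k"] by auto
      have "word_rel n M (v @ x @ [s]) (v @ y)"
        using word_rel_append[OF word_rel_refl[OF vl] y(1)] xs by simp
      then have "word_rel n M (w @ [s]) (v @ y)" by (rule word_rel_trans[OF wsnoc])
      then have "length w \<le> length v + length y" using less.prems(3) by fastforce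
      then show False using y(2) x(3) k_def by simp
    qed
    moreover have "a \<noteq> b"
    proof
      assume "a = b"
      then have "t = s" using ab by auto
      then have "word_rel n M (w @ [s]) (w' @ [])"
        using w'l sn snoc word_rel_append[OF word_rel_refl[OF w'l] word_rel_square[OF sn]] by simp
      then show False using less.prems(3)[of w'] snoc by simp
    qed
    then have "M a b \<noteq> 1" using abn by (intro cox_neq)
    ultimately have "dih (weight M a b) (act M v f a) (act M v f b) k \<ge> 0"
      using g ab by (intro dih_nonneg) auto
    also have "dih (weight M a b) (act M v f a) (act M v f b) k = act M (v @ x) f s"
      unfolding xk sk
      using act_alt_next[OF cox_diag[OF abn(1)] cox_diag[OF abn(2)] cox_sym[OF abn]] by simp
    also have "act M (v @ x) f = act M w f" using word_rel_act[OF x(2)] by simp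
    finally show ?thesis .
  qed
qed

lemma act_fixed_iff:
  assumes "geodesic n M u" and f: "\<And>j. j \<in> {1..n} \<Longrightarrow> f j \<ge> 0"
  shows "(\<forall>j\<in>{1..n}. act M u f j = f j) \<longleftrightarrow> (\<forall>j\<in>set u. f j = 0)"
  using assms(1)
proof (induction u rule: rev_induct)
  case (snoc s u)
  have s: "s \<in> {1..n}" using snoc.prems by (auto simp: geodesic_def)
  have geo: "geodesic n M u" using snoc.prems by (rule geodesic_butlast)
  have "length u \<le> length v" if "word_rel n M (u @ [s]) v" for v
    using snoc.prems that by (force simp: geodesic_def)
  then have pos: "act M u f s \<ge> 0" using geo s f by (intro act_nonneg)
  have neg: "act M (u @ [s]) f s = - act M u f s"
    using cox_diag[OF s] by (simp add: reflect_def weight_diag)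
  show ?case
  proof
    assume fixed: "\<forall>j\<in>{1..n}. act M (u @ [s]) f j = f j"
    then have "- act M u f s = f s" using neg s by metis
    then have "act M u f s = 0" "f s = 0" using pos f[OF s] by linarith+
    then have "\<forall>j\<in>{1..n}. act M u f j = f j" using fixed by (simp add: reflect_fixed)
    then show "\<forall>j\<in>set (u @ [s]). f j = 0" using snoc.IH[OF geo] \<open>f s = 0\<close> by simp
  next
    assume zero: "\<forall>j\<in>set (u @ [s]). f j = 0"
    then have fixed: "\<forall>j\<in>{1..n}. act M u f j = f j" using snoc.IH[OF geo] by simp
    then have "act M u f s = 0" using zero s by simp
    then show "\<forall>j\<in>{1..n}. act M (u @ [s]) f j = f j"
      using fixed by (simp add: reflect_fixed)
  qed
qed simp

section \<open>Letters of the shortlex normal form\<close>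

lemma word_elem_eq_iff:
  assumes "u \<in> lists {1..n}" "v \<in> lists {1..n}"
  shows "word_elem n M u = word_elem n M v \<longleftrightarrow> word_rel n M u v"
  unfolding word_elem_eq_class[OF assms(1)] word_elem_eq_class[OF assms(2)] word_rel_def
  using assms by (intro eq_equiv_class_iff[OF equiv_pres_rel]) (simp_all only: map_Pair_lists)

lemma geodesics_iff:
  assumes "w \<in> lists {1..n}"
  shows "u \<in> geodesics n M (word_elem n M w) \<longleftrightarrow> geodesic n M u \<and> word_rel n M w u"
proof -
  have "word_elem n M v = word_elem n M w \<longleftrightarrow> word_rel n M w v" if "v \<in> lists {1..n}" for v
    using word_elem_eq_iff[OF assms that] by metis
  then show ?thesis
    unfolding geodesics_def geodesic_def
    using word_rel_lists word_rel_sym word_rel_trans by (smt (verit) mem_Collect_eq)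
qed

text \<open>The functional is twice the dual of alpha_i: as 2 = 2 cos 0, its coordinates are a
  single 1.\<close>

lemma shortlex_nf_letter_iff:
  assumes "linear_order_on {1..n} r" "w \<in> lists {1..n}" "i \<in> {1..n}"
  shows "i \<in> set (shortlex_nf n M r (word_elem n M w)) \<longleftrightarrow>
    \<not> (\<forall>j\<in>{1..n}. act M w (\<lambda>j. if j = i then 2 else 0) j = (if j = i then 2 else 0))"
proof -
  let ?f = "\<lambda>j. if j = i then 2 else 0 :: real"
  let ?u = "shortlex_nf n M r (word_elem n M w)"
  have "?u \<in> geodesics n M (word_elem n M w)"
    using theI'[OF shortlex_nf_unique[OF assms(1,2)]] unfolding shortlex_nf_def by blast
  then have u: "geodesic n M ?u" "word_rel n M w ?u" using geodesics_iff[OF assms(2)] by auto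
  have "(\<forall>j\<in>{1..n}. act M ?u ?f j = ?f j) \<longleftrightarrow> (\<forall>j\<in>set ?u. ?f j = 0)"
    by (rule act_fixed_iff[OF u(1)]) simp
  then show ?thesis unfolding word_rel_act[OF u(2)] by auto
qed

end


section \<open>Integer coordinates for cyclotomic values\<close>

text \<open>Either a nonzero multiple \<open>D * x d\<close> is an integer combination of the
  earlier numbers and can be eliminated after scaling by \<open>D\<close>, or the coefficient of
  \<open>x d\<close> must vanish, which is one more condition. The list is only shown to exist; it
  becomes a fixed part of the machine.\<close>

lemma integer_relations:
  fixes x :: "nat \<Rightarrow> real"
  shows "\<exists>ts :: (nat \<Rightarrow> int) list. \<forall>q :: nat \<Rightarrow> int.
    (\<Sum>k<d. of_int (q k) * x k) = 0 \<longleftrightarrow> (\<forall>t\<in>set ts. (\<Sum>k<d. t k * q k) = 0)"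
proof (induction d)
  case 0
  show ?case by (intro exI[of _ "[]"]) simp
next
  case (Suc d)
  then obtain ts :: "(nat \<Rightarrow> int) list" where
    ts: "\<And>q. (\<Sum>k<d. of_int (q k) * x k) = 0 \<longleftrightarrow> (\<forall>t\<in>set ts. (\<Sum>k<d. t k * q k) = 0)"
    by blast
  show ?case
  proof (cases "\<exists>D s. D \<noteq> (0 :: int) \<and> of_int D * x d = (\<Sum>k<d. of_int (s k) * x k)")
    case True
    then obtain D s where D: "D \<noteq> 0" "of_int D * x d = (\<Sum>k<d. of_int (s k) * x k)" by blast
    define f where "f t = (\<lambda>k. if k < d then D * t k else (\<Sum>k<d. t k * s k))" for t :: "nat \<Rightarrow> int"
    have "(\<Sum>k<Suc d. of_int (q k) * x k) = 0 \<longleftrightarrow> (\<forall>t\<in>set (map f ts). (\<Sum>k<Suc d. t k * q k) = 0)" for q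
    proof -
      have "of_int D * (\<Sum>k<Suc d. of_int (q k) * x k)
          = (\<Sum>k<d. of_int D * (of_int (q k) * x k)) + of_int (q d) * (of_int D * x d)"
        by (simp add: sum_distrib_left algebra_simps)
      also have "\<dots> = (\<Sum>k<d. of_int (D * q k + q d * s k) * x k)"
        unfolding D(2) by (simp add: sum_distrib_left sum.distrib[symmetric] algebra_simps)
      finally have "(\<Sum>k<Suc d. of_int (q k) * x k) = 0 \<longleftrightarrow>
          (\<forall>t\<in>set ts. (\<Sum>k<d. t k * (D * q k + q d * s k)) = 0)"
        using D(1) unfolding ts[symmetric] by (metis mult_eq_0_iff of_int_eq_0_iff)
      moreover have "(\<Sum>k<Suc d. f t k * q k) = (\<Sum>k<d. t k * (D * q k + q d * s k))" for t
        by (simp add: f_def sum_distrib_left sum.distrib[symmetric] algebra_simps)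
      ultimately show ?thesis by simp
    qed
    then show ?thesis by blast
  next
    case False
    define f where "f t = t(d := 0 :: int)" for t :: "nat \<Rightarrow> int"
    define e where "e = (\<lambda>k. if k = d then 1 else 0 :: int)"
    have "(\<Sum>k<Suc d. of_int (q k) * x k) = 0 \<longleftrightarrow> (\<forall>t\<in>set (e # map f ts). (\<Sum>k<Suc d. t k * q k) = 0)" for q
    proof -
      have "(\<Sum>k<Suc d. of_int (q k) * x k) = 0 \<longleftrightarrow> q d = 0 \<and> (\<Sum>k<d. of_int (q k) * x k) = 0"
      proof -
        have "q d = 0" if "(\<Sum>k<Suc d. of_int (q k) * x k) = 0"
        proof (rule ccontr)
          assume "q d \<noteq> 0"
          moreover have "of_int (q d) * x d = (\<Sum>k<d. of_int (- q k) * x k)"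
            using that by (simp add: sum_negf)
          ultimately have "\<exists>D s. D \<noteq> (0 :: int) \<and> of_int D * x d = (\<Sum>k<d. of_int (s k) * x k)"
            by (intro exI[of _ "q d"] exI[of _ "\<lambda>k. - q k"] conjI)
          with False show "False" ..
        qed
        then show ?thesis by auto
      qed
      moreover have "(\<Sum>k<Suc d. f t k * q k) = (\<Sum>k<d. t k * q k)" for t by (simp add: f_def)
      moreover have "(\<Sum>k<Suc d. e k * q k) = q d" by (simp add: e_def)
      ultimately show ?thesis by (simp add: ts)
    qed
    then show ?thesis by blast
  qed
qed

definition cosv :: "nat \<Rightarrow> nat \<Rightarrow> real" where
  "cosv L k = 2 * cos (real k * pi / real L)"

lemma cosv_0: "cosv L 0 = 2"
  by (simp add: cosv_def)

lemma cosv_mod: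
  assumes "L > 0"
  shows "cosv L (k mod (2 * L)) = cosv L k"
proof -
  define r where "r = k mod (2 * L)"
  have "k = r + 2 * L * (k div (2 * L))" by (simp add: r_def)
  then have "real k = real r + 2 * real L * real (k div (2 * L))"
    by (metis of_nat_add of_nat_mult of_nat_numeral)
  then have "real k * pi / real L = real r * pi / real L + real (k div (2 * L)) * (2 * pi)"
    using assms by (simp add: field_simps)
  moreover have "cos (y + real m * (2 * pi)) = cos y" for y m
  proof (induction m)
    case (Suc m)
    have "y + real (Suc m) * (2 * pi) = (y + real m * (2 * pi)) + 2 * pi"
      by (simp add: algebra_simps)
    then show ?case using Suc by (simp only: cos_periodic)
  qed simp
  ultimately show ?thesis by (simp add: cosv_def flip: r_def)
qed

text \<open>The product formula for cosines, with indices modulo the period 2L; the summand 2L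
  avoids truncated subtraction.\<close>

lemma cosv_mult:
  assumes "L > 0" "h \<le> L"
  shows "cosv L ((k + h) mod (2 * L)) + cosv L ((k + 2 * L - h) mod (2 * L)) = cosv L h * cosv L k"
proof -
  let ?a = "real k * pi / real L" and ?b = "real h * pi / real L"
  have "real (k + 2 * L - h) * pi / real L = ?a - ?b + 2 * pi"
    using assms by (simp add: of_nat_diff field_simps)
  then have "cosv L (k + 2 * L - h) = 2 * cos (?a - ?b)"
    by (simp only: cosv_def cos_periodic)
  moreover have "cosv L (k + h) = 2 * cos (?a + ?b)"
    by (simp add: cosv_def algebra_simps add_divide_distrib)
  ultimately show ?thesis
    unfolding cosv_mod[OF assms(1)] by (simp add: cosv_def cos_add cos_diff)
qed

text \<open>
  The integers \<open>Y (j, k)\<close> for \<open>k < 2 L\<close> are the coefficients of the value of a functional at the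
  \<open>j\<close>-th simple root with respect to the numbers \<open>2 cos (k \<pi> / L)\<close>.
\<close>

definition evl :: "nat \<Rightarrow> (nat \<times> nat \<Rightarrow> int) \<Rightarrow> nat \<Rightarrow> real" where
  "evl L Y j = (\<Sum>k<2 * L. of_int (Y (j, k)) * cosv L k)"

lemma evl_cong: "(\<And>k. Y' (j, k) = Y (j, k)) \<Longrightarrow> evl L Y' j = evl L Y j"
  by (simp add: evl_def)

lemma evl_Add:
  assumes "l < 2 * L"
  shows "evl L (lin_step (Add (j, l) v) Y) j = evl L Y j + of_int (Y v) * cosv L l"
proof -
  have "evl L (lin_step (Add (j, l) v) Y) j
      = (\<Sum>k<2 * L. of_int (Y (j, k)) * cosv L k + (if k = l then of_int (Y v) * cosv L l else 0))"
    unfolding evl_def by (intro sum.cong) (auto simp: algebra_simps)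
  then show ?thesis using assms by (simp add: sum.distrib evl_def)
qed

definition shear :: "nat \<Rightarrow> nat \<Rightarrow> nat \<Rightarrow> nat \<Rightarrow> nat list \<Rightarrow> (nat \<times> nat) lin list" where
  "shear L h a j ks = concat (map (\<lambda>k. [Add (j, (k + h) mod (2 * L)) (a, k),
    Add (j, (k + 2 * L - h) mod (2 * L)) (a, k)]) ks)"

lemma shear_other: "i \<noteq> j \<Longrightarrow> lin_run (shear L h a j ks) Y (i, k) = Y (i, k)"
  by (induction ks arbitrary: Y) (auto simp: shear_def)

lemma evl_shear:
  assumes "L > 0" "h \<le> L" "a \<noteq> j"
  shows "evl L (lin_run (shear L h a j ks) Y) j =
    evl L Y j + cosv L h * (\<Sum>k\<leftarrow>ks. of_int (Y (a, k)) * cosv L k)"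
proof (induction ks arbitrary: Y)
  case (Cons k ks)
  let ?l = "(k + h) mod (2 * L)" and ?l' = "(k + 2 * L - h) mod (2 * L)"
  define Y1 where "Y1 = lin_step (Add (j, ?l) (a, k)) Y"
  define Y2 where "Y2 = lin_step (Add (j, ?l') (a, k)) Y1"
  have l: "?l < 2 * L" "?l' < 2 * L" using assms(1) by simp_all
  have a: "Y1 (a, k') = Y (a, k')" "Y2 (a, k') = Y (a, k')" for k'
    using assms(3) by (auto simp: Y1_def Y2_def)
  have "evl L Y1 j = evl L Y j + of_int (Y (a, k)) * cosv L ?l"
    unfolding Y1_def by (rule evl_Add[OF l(1)])
  moreover have "evl L Y2 j = evl L Y1 j + of_int (Y1 (a, k)) * cosv L ?l'"
    unfolding Y2_def by (rule evl_Add[OF l(2)])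
  ultimately have "evl L Y2 j = evl L Y j + of_int (Y (a, k)) * (cosv L ?l + cosv L ?l')"
    unfolding a by (simp add: algebra_simps)
  moreover have "lin_run (shear L h a j (k # ks)) Y = lin_run (shear L h a j ks) Y2"
    by (simp add: shear_def Y1_def Y2_def)
  ultimately show ?case
    unfolding cosv_mult[OF assms(1,2)] by (simp add: Cons.IH a algebra_simps)
qed (simp add: shear_def)

lemma evl_shear_full:
  assumes "L > 0" "h \<le> L" "a \<noteq> j"
  shows "evl L (lin_run (shear L h a j [0..<2 * L]) Y) j = evl L Y j + cosv L h * evl L Y a"
  unfolding evl_shear[OF assms] evl_def[of L Y a]
  by (simp add: interv_sum_list_conv_sum_set_nat atLeast0LessThan)

text \<open>The index of the weight among the cosines: pi / m is (L / m) pi / L, and the value 2 for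
  m = 0 is found at index 0.\<close>

definition shift :: "nat \<Rightarrow> (nat \<Rightarrow> nat \<Rightarrow> nat) \<Rightarrow> nat \<Rightarrow> nat \<Rightarrow> nat" where
  "shift L M a j = (if M a j = 0 then 0 else L div M a j)"

lemma shift_le: "shift L M a j \<le> L"
  by (simp add: shift_def)

lemma cosv_shift:
  assumes "L > 0" "M a j = 0 \<or> M a j dvd L"
  shows "cosv L (shift L M a j) = weight M a j"
  using assms by (auto simp: cosv_def shift_def weight_def real_of_nat_div)

definition shears :: "nat \<Rightarrow> (nat \<Rightarrow> nat \<Rightarrow> nat) \<Rightarrow> nat \<Rightarrow> nat list \<Rightarrow> (nat \<times> nat) lin list" where
  "shears L M a js =
    concat (map (\<lambda>j. if j = a then [] else shear L (shift L M a j) a j [0..<2 * L]) js)"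

lemma shears_other: "i = a \<or> i \<notin> set js \<Longrightarrow> lin_run (shears L M a js) Y (i, k) = Y (i, k)"
  by (induction js arbitrary: Y) (auto simp: shears_def shear_other)

lemma evl_shears:
  assumes "L > 0" "distinct js" "j \<in> set js" "j \<noteq> a"
  shows "evl L (lin_run (shears L M a js) Y) j = evl L Y j + cosv L (shift L M a j) * evl L Y a"
  using assms(2,3)
proof (induction js arbitrary: Y)
  case (Cons i js)
  define Y1 where
    "Y1 = lin_run (if i = a then [] else shear L (shift L M a i) a i [0..<2 * L]) Y"
  have run: "lin_run (shears L M a (i # js)) Y = lin_run (shears L M a js) Y1"
    by (simp add: shears_def Y1_def)
  have a: "evl L Y1 a = evl L Y a"
    by (rule evl_cong) (simp add: Y1_def shear_other)
  show ?case
  proof (cases "j = i")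
    case True
    then have "evl L (lin_run (shears L M a js) Y1) j = evl L Y1 j"
      using Cons.prems by (intro evl_cong shears_other) auto
    also have "\<dots> = evl L Y j + cosv L (shift L M a j) * evl L Y a"
      using True assms(1,4) by (simp add: Y1_def evl_shear_full shift_le)
    finally show ?thesis unfolding run .
  next
    case False
    then have "evl L Y1 j = evl L Y j" by (intro evl_cong) (simp add: Y1_def shear_other)
    then show ?thesis unfolding run using Cons False a by simp
  qed
qed simp

lemma lin_run_Neg:
  "distinct vs \<Longrightarrow> lin_run (map Neg vs) Y v = (if v \<in> set vs then - Y v else Y v)"
  by (induction vs arbitrary: Y) auto

text \<open>All shears read row \<open>a\<close>, so it is negated last. A shear of row
  \<open>a\<close> into itself would overwrite its own source.\<close>

definition reflect_code :: "nat \<Rightarrow> (nat \<Rightarrow> nat \<Rightarrow> nat) \<Rightarrow> nat \<Rightarrow> nat \<Rightarrow> (nat \<times> nat) lin list" where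
  "reflect_code L M n a = shears L M a [1..<n + 1] @ map Neg (map (Pair a) [0..<2 * L])"

lemma reflect_code_run:
  "lin_run (reflect_code L M n a) Y (i, k) =
    (if i = a \<and> k < 2 * L then - Y (a, k) else lin_run (shears L M a [1..<n + 1]) Y (i, k))"
proof -
  have "distinct (map (Pair a) [0..<2 * L])" by (simp add: distinct_map inj_on_def)
  then have "lin_run (reflect_code L M n a) Y (i, k) = (if (i, k) \<in> set (map (Pair a) [0..<2 * L])
      then - lin_run (shears L M a [1..<n + 1]) Y (i, k)
      else lin_run (shears L M a [1..<n + 1]) Y (i, k))"
    unfolding reflect_code_def fold_append comp_def by (rule lin_run_Neg)
  then show ?thesis by (auto simp: shears_other)
qed

lemma evl_reflect_code:
  assumes "L > 0" "\<And>j. j \<in> {1..n} \<Longrightarrow> M a j = 0 \<or> M a j dvd L" "M a a = 1" "j \<in> {1..n}"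
  shows "evl L (lin_run (reflect_code L M n a) Y) j = reflect M a (evl L Y) j"
proof (cases "j = a")
  case True
  then show ?thesis
    by (simp add: evl_def reflect_code_run reflect_def weight_diag[of M a, OF assms(3)] sum_negf)
next
  case False
  then have "evl L (lin_run (reflect_code L M n a) Y) j = evl L (lin_run (shears L M a [1..<n + 1]) Y) j"
    by (intro evl_cong) (simp only: reflect_code_run, simp)
  also have "\<dots> = evl L Y j + cosv L (shift L M a j) * evl L Y a"
    using assms(1,4) False by (intro evl_shears) auto
  finally show ?thesis
    using assms(2)[OF assms(4)] by (simp add: cosv_shift[OF assms(1)] reflect_def)
qed

lemma reflect_code_0: "a \<noteq> 0 \<Longrightarrow> lin_run (reflect_code L M n a) Y (0, k) = Y (0, k)"
  by (simp add: reflect_code_run shears_other)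

text \<open>Row 0 belongs to no generator and survives all reflections; its entry (0, 0) collects
  the value to be tested.\<close>

definition entries :: "nat \<Rightarrow> nat \<Rightarrow> (nat \<times> nat) set" where
  "entries L n = {0..n} \<times> {..<2 * L}"

lemma lin_in_reflect_code:
  assumes "L > 0" "a \<in> {1..n}" "e \<in> set (reflect_code L M n a)"
  shows "lin_in (entries L n) e"
  using assms by (auto simp: reflect_code_def shears_def shear_def entries_def split: if_splits)

text \<open>Subtraction is addition conjugated by negation of the target.\<close>

definition times_add :: "'v \<Rightarrow> int \<Rightarrow> 'v \<Rightarrow> 'v lin list" where
  "times_add z c v = (if c \<ge> 0 then replicate (nat c) (Add z v)
    else [Neg z] @ replicate (nat (- c)) (Add z v) @ [Neg z])"

lemma funpow_lin_step_Add:
  "z \<noteq> v \<Longrightarrow> (lin_step (Add z v) ^^ c) Y = Y(z := Y z + int c * Y v)"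
  by (induction c) (auto simp: algebra_simps fun_eq_iff)

lemma lin_run_times_add: "z \<noteq> v \<Longrightarrow> lin_run (times_add z c v) Y = Y(z := Y z + c * Y v)"
  by (auto simp: times_add_def funpow_lin_step_Add fun_eq_iff)

definition functional_code :: "nat \<Rightarrow> (nat \<Rightarrow> int) \<Rightarrow> nat \<Rightarrow> (nat \<times> nat) lin list" where
  "functional_code L t j = concat (map (\<lambda>k. times_add (0, 0) (t k) (j, k)) [0..<2 * L])"

lemma lin_run_functional_code:
  assumes "j \<noteq> 0"
  shows "lin_run (functional_code L t j) Y (0, 0) = Y (0, 0) + (\<Sum>k<2 * L. t k * Y (j, k))"
proof -
  have "lin_run (concat (map (\<lambda>k. times_add (0, 0) (t k) (j, k)) ks)) Y (0, 0)
      = Y (0, 0) + (\<Sum>k\<leftarrow>ks. t k * Y (j, k))" for ks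
    using assms by (induction ks arbitrary: Y) (auto simp: lin_run_times_add)
  then show ?thesis
    by (simp add: functional_code_def interv_sum_list_conv_sum_set_nat atLeast0LessThan)
qed

text \<open>\<open>Neg\<close>, \<open>One\<close>, \<open>Neg\<close> subtract 1 from entry (i, 0),
  the only coordinate of the original functional, so the relation is tested on the difference
  between the moved functional and the original.\<close>

definition final_code :: "nat \<Rightarrow> nat \<Rightarrow> (nat \<Rightarrow> int) \<Rightarrow> nat \<Rightarrow> (nat \<times> nat) lin list" where
  "final_code L i t j =
    (if j = i then [Neg (i, 0), One (i, 0), Neg (i, 0)] else []) @ functional_code L t j"

lemma lin_in_final_code:
  assumes "L > 0" "i \<in> {1..n}" "j \<in> {1..n}" "e \<in> set (final_code L i t j)"
  shows "lin_in (entries L n) e"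
  using assms
  by (auto simp: final_code_def functional_code_def times_add_def entries_def split: if_splits)

lemma lin_run_final_code:
  assumes "j \<noteq> 0"
  shows "lin_run (final_code L i t j) Y (0, 0) =
    Y (0, 0) + (\<Sum>k<2 * L. t k * (Y (j, k) - of_bool (j = i \<and> k = 0)))"
  using assms
  by (auto simp: final_code_def lin_run_functional_code intro!: sum.cong)


section \<open>Fixed functionals as integer zero tests\<close>

context
  fixes n :: nat and M :: "nat \<Rightarrow> nat \<Rightarrow> nat" and L :: nat
  assumes cox: "coxeter_matrix n M"
    and L: "L > 0" "\<And>a j. a \<in> {1..n} \<Longrightarrow> j \<in> {1..n} \<Longrightarrow> M a j = 0 \<or> M a j dvd L"
begin

lemma evl_word:
  assumes "w \<in> lists {1..n}" "j \<in> {1..n}" "\<And>j. j \<in> {1..n} \<Longrightarrow> evl L Y j = f j"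
  shows "evl L (fold (\<lambda>a. lin_run (reflect_code L M n a)) w Y) j = act M w f j"
  using assms(1,3)
proof (induction w arbitrary: Y f rule: list.induct)
  case (Cons a w)
  have a: "a \<in> {1..n}" "w \<in> lists {1..n}" using Cons.prems(1) by auto
  have "evl L (lin_run (reflect_code L M n a) Y) i = reflect M a f i" if "i \<in> {1..n}" for i
  proof -
    have "evl L (lin_run (reflect_code L M n a) Y) i = reflect M a (evl L Y) i"
      using L(1) L(2)[OF a(1)] cox_diag[OF cox a(1)] that by (rule evl_reflect_code)
    also have "\<dots> = reflect M a f i"
      using Cons.prems(2)[OF a(1)] Cons.prems(2)[OF that] by (simp add: reflect_def)
    finally show ?thesis .
  qed
  then show ?case using Cons.IH[OF a(2)] by simp
qed (use assms(2) in simp)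

lemma fold_reflect_code_0:
  "w \<in> lists {1..n} \<Longrightarrow> fold (\<lambda>a. lin_run (reflect_code L M n a)) w Y (0, k) = Y (0, k)"
proof (induction w arbitrary: Y rule: list.induct)
  case (Cons a w)
  then show ?case using reflect_code_0[of a] by auto
qed simp

lemma fixed_iff_lin_values:
  assumes w: "w \<in> lists {1..n}" and i: "i \<in> {1..n}"
    and ts: "\<And>q. (\<Sum>k<2 * L. of_int (q k) * cosv L k) = 0 \<longleftrightarrow>
      (\<forall>t\<in>set ts. (\<Sum>k<2 * L. t k * q k) = 0)"
  shows "(\<forall>j\<in>{1..n}. act M w (\<lambda>j. if j = i then 2 else 0) j = (if j = i then 2 else 0)) \<longleftrightarrow>
    (\<forall>j\<in>{1..n}. \<forall>t\<in>set ts.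
      lin_value (reflect_code L M n) w ([One (i, 0)], final_code L i t j) (0, 0) = 0)"
proof (rule ball_cong[OF HOL.refl])
  fix j assume j: "j \<in> {1..n}"
  let ?f = "\<lambda>j. if j = i then 2 else 0 :: real"
  define Y0 :: "nat \<times> nat \<Rightarrow> int" where "Y0 = lin_run [One (i, 0)] (\<lambda>_. 0)"
  define Y where "Y = fold (\<lambda>a. lin_run (reflect_code L M n a)) w Y0"
  have kron: "(\<Sum>k<2 * L. of_int (of_bool (j' = i \<and> k = 0)) * cosv L k) = ?f j'" for j'
  proof -
    have "(\<Sum>k<2 * L. of_int (of_bool (j' = i \<and> k = 0)) * cosv L k)
        = (\<Sum>k<2 * L. if k = 0 then ?f j' else 0)"
      by (intro sum.cong) (auto simp: cosv_0)
    then show ?thesis using L(1) by simp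
  qed
  have "evl L Y0 j' = ?f j'" for j'
    unfolding evl_def kron[symmetric] by (intro sum.cong) (auto simp: Y0_def)
  then have "evl L Y j = act M w ?f j"
    unfolding Y_def using w j by (intro evl_word)
  then have "act M w ?f j = ?f j \<longleftrightarrow>
      (\<Sum>k<2 * L. of_int (Y (j, k) - of_bool (j = i \<and> k = 0)) * cosv L k) = 0"
    unfolding evl_def kron[of j, symmetric] by (simp add: left_diff_distrib sum_subtractf)
  also have "\<dots> \<longleftrightarrow> (\<forall>t\<in>set ts. (\<Sum>k<2 * L. t k * (Y (j, k) - of_bool (j = i \<and> k = 0))) = 0)"
    by (rule ts)
  also have "\<dots> \<longleftrightarrow> (\<forall>t\<in>set ts.
      lin_value (reflect_code L M n) w ([One (i, 0)], final_code L i t j) (0, 0) = 0)"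
  proof (rule ball_cong[OF HOL.refl])
    fix t
    have "Y (0, 0) = 0"
      unfolding Y_def fold_reflect_code_0[OF w] using i by (simp add: Y0_def)
    moreover have "lin_value (reflect_code L M n) w ([One (i, 0)], final_code L i t j)
        = lin_run (final_code L i t j) Y"
      by (simp add: lin_value_def Y_def Y0_def)
    ultimately show "(\<Sum>k<2 * L. t k * (Y (j, k) - of_bool (j = i \<and> k = 0))) = 0 \<longleftrightarrow>
        lin_value (reflect_code L M n) w ([One (i, 0)], final_code L i t j) (0, 0) = 0"
      using j by (simp add: lin_run_final_code)
  qed
  finally show "act M w ?f j = ?f j \<longleftrightarrow> (\<forall>t\<in>set ts.
      lin_value (reflect_code L M n) w ([One (i, 0)], final_code L i t j) (0, 0) = 0)" .
qed

end


theorem theorem5: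
  fixes n :: nat and M :: "nat \<Rightarrow> nat \<Rightarrow> nat" and r :: "nat rel"
  assumes "coxeter_matrix n M"
    and "linear_order_on {1..n} r"
  shows "\<exists>T :: (nat, nat, nat, nat) transducer.
    logspace_transducer {1..n} {1..n} T \<and>
    (\<forall>w\<in>lists {1..n}.
      computes T w (sorted_list_of_set (set (shortlex_nf n M r (word_elem n M w)))))"
proof -
  \<comment> \<open>A common multiple of the finite entries, so that all angles pi / m are multiples
    of pi / L; entries 0 count as 1 to keep \<open>L\<close> positive.\<close>
  define L where "L = (\<Prod>a\<in>{1..n}. \<Prod>j\<in>{1..n}. if M a j = 0 then 1 else M a j)"
  have L0: "L > 0" unfolding L_def by (intro prod_pos) auto
  have Ldvd: "M a j = 0 \<or> M a j dvd L" if "a \<in> {1..n}" "j \<in> {1..n}" for a j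
  proof -
    have "(if M a j = 0 then 1 else M a j) dvd (\<Prod>j\<in>{1..n}. if M a j = 0 then 1 else M a j)"
      using that by (intro dvd_prodI) auto
    also have "\<dots> dvd L" unfolding L_def using that by (intro dvd_prodI) auto
    finally show ?thesis by (simp split: if_splits)
  qed
  obtain ts :: "(nat \<Rightarrow> int) list" where
    ts: "\<And>q. (\<Sum>k<2 * L. of_int (q k) * cosv L k) = 0 \<longleftrightarrow>
      (\<forall>t\<in>set ts. (\<Sum>k<2 * L. t k * q k) = 0)"
    using integer_relations by blast
  define ys where "ys = [1..<n + 1]"
  define tests where
    "tests i = concat (map (\<lambda>j. map (\<lambda>t. ([One (i, 0 :: nat)], final_code L i t j)) ts) ys)" for i
  have ys: "set ys = {1..n}" by (auto simp: ys_def)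
  have "\<exists>T :: (nat, nat, nat, nat) transducer. logspace_transducer {1..n} (set ys) T \<and>
    (\<forall>w\<in>lists {1..n}. computes T w
      (filter (\<lambda>i. \<exists>t\<in>set (tests i). lin_value (reflect_code L M n) w t (0, 0) \<noteq> 0) ys))"
  proof (rule logspace_linear_tests[where V = "entries L n"])
    show "lin_in (entries L n) e"
      if asm: "i \<in> set ys" "t \<in> set (tests i)" "e \<in> set (fst t @ snd t)" for i t e
    proof -
      have i: "i \<in> {1..n}" using asm(1) ys by simp
      obtain j t' where t: "j \<in> {1..n}" "t = ([One (i, 0)], final_code L i t' j)"
        using asm(2) ys by (auto simp: tests_def)
      have "lin_in (entries L n) (One (i, 0))" using i L0 by (simp add: entries_def)
      then show ?thesis
        using asm(3) lin_in_final_code[OF L0 i t(1)] unfolding t(2) by auto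
    qed
  qed (use L0 lin_in_reflect_code in \<open>auto simp: entries_def\<close>)
  moreover have "filter (\<lambda>i. \<exists>t\<in>set (tests i). lin_value (reflect_code L M n) w t (0, 0) \<noteq> 0) ys
      = sorted_list_of_set (set (shortlex_nf n M r (word_elem n M w)))"
    if w: "w \<in> lists {1..n}" for w
  proof -
    let ?u = "shortlex_nf n M r (word_elem n M w)"
    let ?sel = "\<lambda>i. \<exists>t\<in>set (tests i). lin_value (reflect_code L M n) w t (0, 0) \<noteq> 0"
    have "?u \<in> geodesics n M (word_elem n M w)"
      using theI'[OF shortlex_nf_unique[OF assms(2) w]] unfolding shortlex_nf_def by blast
    then have u: "set ?u \<subseteq> {1..n}" unfolding geodesics_def by auto
    have "?sel i \<longleftrightarrow> i \<in> set ?u" if i: "i \<in> {1..n}" for i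
    proof -
      have "?sel i \<longleftrightarrow> \<not> (\<forall>j\<in>{1..n}. \<forall>t\<in>set ts.
          lin_value (reflect_code L M n) w ([One (i, 0)], final_code L i t j) (0, 0) = 0)"
        by (auto simp: tests_def ys)
      then show ?thesis
        using shortlex_nf_letter_iff[OF assms(1,2) w i]
          fixed_iff_lin_values[OF assms(1) L0 Ldvd w i ts] by (simp only:)
    qed
    then have "set (filter ?sel ys) = set ?u" using u ys by auto
    moreover have "sorted ys" "distinct ys" by (simp_all add: ys_def del: upt_Suc)
    then have "sorted (filter ?sel ys)" "distinct (filter ?sel ys)"
      by (simp_all only: sorted_wrt_filter distinct_filter)
    then have "sorted_list_of_set (set (filter ?sel ys)) = filter ?sel ys"
      by (rule sorted_list_of_set.idem_if_sorted_distinct)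
    ultimately show ?thesis by (simp only:)
  qed
  ultimately show ?thesis unfolding ys by (simp cong: ball_cong)
qed

end
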